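(* Suppose that for some fixed $\varepsilon>0$ there is an algorithm that solves \textsc{Maximum Local Edge Connectivity} on directed graphs with $n$ nodes and $\tilde O(n)$ edges in time $O(n^{2-\varepsilon})$. Then there is $\delta=\delta(\varepsilon)>0$ such that MAX-CNF-SAT on $n'$ variables and $O(n')$ clauses can be solved in time $O(2^{(1-\delta)n'})$; in particular, SETH is false.
   Context: \textsc{Maximum Local Edge Connectivity}: given a directed graph $G=(V,E)$, output the maximum, over all pairs $u,v\in V$, of the maximum number of pairwise edge-disjoint directed $uv$-paths in $G$. MAX-CNF-SAT: given a CNF formula, output the maximum number of its clauses that can be simultaneously satisfied. SETH: for every fixed $\varepsilon>0$ there is an integer $k\ge3$ such that $k$-SAT on $n$ variables and $m$ clauses cannot be solved in time $2^{(1-\varepsilon)n}\mathrm{poly}(m)$. $\tilde O(f)$ means $O(f\log^c f)$ for some constant $c$. *)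

theory Defs
  imports
    Complex_Main
    "HOL-Library.Landau_Symbols"
    "HOL-Computational_Algebra.Polynomial"
    "Graph_Theory.Digraph"
    "Graph_Theory.Arc_Walk"
begin

section \<open>Word RAM\<close>

text \<open>
  Algorithms are programs of a deterministic unit-cost word RAM with word length \<open>w\<close>. A program
  uses finitely many registers and finitely many arrays (with addresses below \<open>2 ^ w\<close>); up to
  constant factors in the running time and in the word length this is the same as a single random
  access memory. Control flow is structured, which is again equivalent to jumps up to a constant
  factor.
\<close>

type_synonym reg = nat
type_synonym arr = nat

datatype binop =
  Plus | Minus | Times | Div | Mod | Less | Equal | And | Or | Xor | ShiftL | ShiftR

text \<open>Subtraction is truncated at 0, division by 0 yields 0.\<close>

fun eval_binop :: "binop \<Rightarrow> nat \<Rightarrow> nat \<Rightarrow> nat" where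
  "eval_binop Plus a b = a + b"
| "eval_binop Minus a b = a - b"
| "eval_binop Times a b = a * b"
| "eval_binop Div a b = a div b"
| "eval_binop Mod a b = a mod b"
| "eval_binop Less a b = of_bool (a < b)"
| "eval_binop Equal a b = of_bool (a = b)"
| "eval_binop And a b = Bit_Operations.and a b"
| "eval_binop Or a b = Bit_Operations.or a b"
| "eval_binop Xor a b = Bit_Operations.xor a b"
| "eval_binop ShiftL a b = push_bit b a"
| "eval_binop ShiftR a b = drop_bit b a"

datatype program =
  Skip
| Const reg nat
| Op binop reg reg reg
| Load reg arr reg
| Store arr reg reg
| Seq program program
| Cond reg program program
| While reg program

type_synonym state = "(reg \<Rightarrow> nat) \<times> (arr \<Rightarrow> nat \<Rightarrow> nat)"

text \<open>
  \<open>exec w P s t s'\<close>: with word length \<open>w\<close>, program \<open>P\<close> started in \<open>s\<close> halts in \<open>s'\<close> after \<open>t\<close>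
  steps. Every instruction and every test of a register against 0 is one step. There is no
  wrap-around: a run that would produce a value not fitting into a word has no derivation.
\<close>

inductive exec :: "nat \<Rightarrow> program \<Rightarrow> state \<Rightarrow> nat \<Rightarrow> state \<Rightarrow> bool" for w :: nat where
  Skip: "exec w Skip s 1 s"
| Const: "k < 2 ^ w \<Longrightarrow> exec w (Const r k) (R, M) 1 (R(r := k), M)"
| Op: "eval_binop f (R a) (R b) < 2 ^ w \<Longrightarrow>
    exec w (Op f r a b) (R, M) 1 (R(r := eval_binop f (R a) (R b)), M)"
| Load: "exec w (Load r A a) (R, M) 1 (R(r := M A (R a)), M)"
| Store: "exec w (Store A a b) (R, M) 1 (R, M(A := (M A)(R a := R b)))"
| Seq: "exec w P s t s' \<Longrightarrow> exec w Q s' t' s'' \<Longrightarrow> exec w (Seq P Q) s (t + t') s''"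
| CondTrue: "R r \<noteq> 0 \<Longrightarrow> exec w P (R, M) t s' \<Longrightarrow> exec w (Cond r P Q) (R, M) (1 + t) s'"
| CondFalse: "R r = 0 \<Longrightarrow> exec w Q (R, M) t s' \<Longrightarrow> exec w (Cond r P Q) (R, M) (1 + t) s'"
| WhileTrue: "R r \<noteq> 0 \<Longrightarrow> exec w P (R, M) t s' \<Longrightarrow> exec w (While r P) s' t' s'' \<Longrightarrow>
    exec w (While r P) (R, M) (1 + t + t') s''"
| WhileFalse: "R r = 0 \<Longrightarrow> exec w (While r P) (R, M) 1 (R, M)"

text \<open>
  The input is in array 0, its length in register 0, everything else is 0. The output is the final
  content of register 0.
\<close>

definition init_state :: "nat list \<Rightarrow> state" where
  "init_state xs =
     ((\<lambda>_. 0)(0 := length xs),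
      (\<lambda>_ _. 0)(0 := (\<lambda>i. if i < length xs then xs ! i else 0)))"

definition computes :: "nat \<Rightarrow> program \<Rightarrow> nat list \<Rightarrow> nat \<Rightarrow> nat \<Rightarrow> bool" where
  "computes w P xs t y \<longleftrightarrow>
     length xs < 2 ^ w \<and> (\<forall>x\<in>set xs. x < 2 ^ w) \<and>
     (\<exists>R M. exec w P (init_state xs) t (R, M) \<and> R 0 = y)"

text \<open>
  \<open>solves P I enc ans T\<close>: on every instance \<open>x\<close> with \<open>I x\<close>, encoded as \<open>enc x\<close>, program \<open>P\<close>
  outputs \<open>ans x\<close> within \<open>T x\<close> steps. The word length is logarithmic in the input size and the time
  bound, that is, \<open>O(log n)\<close> bits when both are polynomial in \<open>n\<close> and \<open>O(n)\<close> bits when the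
  time is \<open>2 ^ O(n)\<close>. The sum of the entries in the logarithm accounts for their magnitude.
\<close>

definition solves ::
  "program \<Rightarrow> ('i \<Rightarrow> bool) \<Rightarrow> ('i \<Rightarrow> nat list) \<Rightarrow> ('i \<Rightarrow> nat) \<Rightarrow> ('i \<Rightarrow> real) \<Rightarrow> bool" where
  "solves P I enc ans T \<longleftrightarrow>
     (\<exists>c::real. \<forall>x. I x \<longrightarrow>
        (\<exists>w t. computes w P (enc x) t (ans x) \<and> real t \<le> T x \<and>
               real w \<le> c * log 2 (2 + real (length (enc x)) + real (sum_list (enc x)) + T x)))"

definition soft_O :: "(nat \<Rightarrow> real) \<Rightarrow> (nat \<Rightarrow> real) set" where
  "soft_O f = (\<Union>c::nat. O(\<lambda>n. f n * ln (f n) ^ c))"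


section \<open>Maximum Local Edge Connectivity\<close>

text \<open>
  In both definitions 0 resp. the empty family makes the set nonempty. The endpoints have to be
  distinct, as the empty path from a vertex to itself is edge-disjoint from itself.
\<close>

definition local_edge_connectivity :: "('a, 'b) pre_digraph \<Rightarrow> 'a \<Rightarrow> 'a \<Rightarrow> nat" where
  "local_edge_connectivity G u v =
     Max {card P |P. (\<forall>p\<in>P. pre_digraph.apath G u p v) \<and>
                     (\<forall>p\<in>P. \<forall>q\<in>P. p \<noteq> q \<longrightarrow> set p \<inter> set q = {})}"

definition max_local_edge_connectivity :: "('a, 'b) pre_digraph \<Rightarrow> nat" where
  "max_local_edge_connectivity G =
     Max (insert 0 {local_edge_connectivity G u v |u v. u \<in> verts G \<and> v \<in> verts G \<and> u \<noteq> v})"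

text \<open>Graphs are given by their number of vertices and a list of their edges in any order.\<close>

definition digraph_of :: "nat \<times> (nat \<times> nat) list \<Rightarrow> (nat, nat \<times> nat) pre_digraph" where
  "digraph_of = (\<lambda>(n, es). \<lparr>verts = {..<n}, arcs = set es, tail = fst, head = snd\<rparr>)"

definition is_digraph :: "nat \<times> (nat \<times> nat) list \<Rightarrow> bool" where
  "is_digraph = (\<lambda>(n, es). distinct es \<and> digraph (digraph_of (n, es)))"

definition enc_digraph :: "nat \<times> (nat \<times> nat) list \<Rightarrow> nat list" where
  "enc_digraph = (\<lambda>(n, es). n # length es # concat (map (\<lambda>(u, v). [u, v]) es))"


section \<open>Satisfiability\<close>

text \<open>
  The literal \<open>(x, True)\<close> is the variable \<open>x\<close>, and \<open>(x, False)\<close> is its negation. A formula may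
  contain a clause more than once, and is given together with the number of its variables.
\<close>

type_synonym literal = "nat \<times> bool"
type_synonym clause = "literal list"
type_synonym cnf = "nat \<times> clause list"

definition is_cnf :: "cnf \<Rightarrow> bool" where
  "is_cnf = (\<lambda>(n, F). \<forall>C\<in>set F. distinct C \<and> (\<forall>(x, b)\<in>set C. x < n))"

definition is_kcnf :: "nat \<Rightarrow> cnf \<Rightarrow> bool" where
  "is_kcnf k = (\<lambda>(n, F). is_cnf (n, F) \<and> (\<forall>C\<in>set F. length C \<le> k))"

definition satisfies :: "(nat \<Rightarrow> bool) \<Rightarrow> clause \<Rightarrow> bool" where
  "satisfies \<sigma> C \<longleftrightarrow> (\<exists>(x, b)\<in>set C. \<sigma> x = b)"

definition max_sat :: "cnf \<Rightarrow> nat" where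
  "max_sat = (\<lambda>(n, F). Max {length (filter (satisfies \<sigma>) F) |\<sigma>. True})"

definition satisfiable :: "cnf \<Rightarrow> bool" where
  "satisfiable = (\<lambda>(n, F). \<exists>\<sigma>. \<forall>C\<in>set F. satisfies \<sigma> C)"

definition enc_cnf :: "cnf \<Rightarrow> nat list" where
  "enc_cnf = (\<lambda>(n, F). n # length F #
     concat (map (\<lambda>C. length C # map (\<lambda>(x, b). 2 * x + of_bool b) C) F))"

definition SETH :: bool where
  "SETH \<longleftrightarrow> (\<forall>\<epsilon>>0. \<exists>k\<ge>3. \<not> (\<exists>P (p :: real poly).
     solves P (is_kcnf k) enc_cnf (\<lambda>\<phi>. of_bool (satisfiable \<phi>))
       (\<lambda>(n, F). 2 powr ((1 - \<epsilon>) * real n) * poly p (real (length F)))))"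

end

theory Submission
  imports Defs "HOL-Real_Asymp.Real_Asymp"
begin

text \<open>
  Split the variables into two halves and take a source for each assignment \<open>a\<close> to the first half, a sink
  for each assignment \<open>b\<close> to the second, and two vertices \<open>c\<close>, \<open>d\<close> for each clause. The source \<open>a\<close> has
  one edge per clause, to \<open>c\<close> if \<open>a\<close> satisfies the clause and to \<open>d\<close> otherwise; \<open>c\<close> has an edge
  to every sink, and \<open>d\<close> has one exactly to the sinks \<open>b\<close> that satisfy the clause. All paths from
  \<open>a\<close> to \<open>b\<close> have length 2 and are edge-disjoint, and there is one for each clause satisfied by
  \<open>a\<close> and \<open>b\<close> together. Every other pair of vertices has connectivity at most 1.
  On a graph with \<open>O(2 ^ (n / 2) * m)\<close> vertices and edges, a solver running in time \<open>O(N powr (2 - \<epsilon>))\<close> takes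
  time \<open>2 powr ((1 - \<epsilon> / 2) * n)\<close> up to a polynomial factor in \<open>m\<close>.
\<close>

section \<open>Running programs\<close>

text \<open>Read as a weakest precondition: with the equivalences below, \<open>simp\<close>
  executes straight-line code symbolically. \<open>Q\<close> also receives the step count, so
  correctness and running time are proved together.\<close>

definition terminates :: "nat \<Rightarrow> program \<Rightarrow> state \<Rightarrow> (nat \<Rightarrow> state \<Rightarrow> bool) \<Rightarrow> bool" where
  "terminates w P s Q \<longleftrightarrow> (\<exists>t s'. exec w P s t s' \<and> Q t s')"

lemma exec_Skip_iff: "exec w Skip s t s' \<longleftrightarrow> t = 1 \<and> s' = s"
  by (subst exec.simps) auto

lemma exec_Const_iff:
  "exec w (Const r k) (R, M) t s' \<longleftrightarrow> k < 2 ^ w \<and> t = 1 \<and> s' = (R(r := k), M)"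
  by (subst exec.simps) auto

lemma exec_Op_iff:
  "exec w (Op f r a b) (R, M) t s' \<longleftrightarrow> eval_binop f (R a) (R b) < 2 ^ w \<and>
     t = 1 \<and> s' = (R(r := eval_binop f (R a) (R b)), M)"
  by (subst exec.simps) auto

lemma exec_Load_iff:
  "exec w (Load r A a) (R, M) t s' \<longleftrightarrow> t = 1 \<and> s' = (R(r := M A (R a)), M)"
  by (subst exec.simps) auto

lemma exec_Store_iff:
  "exec w (Store A a b) (R, M) t s' \<longleftrightarrow> t = 1 \<and> s' = (R, M(A := (M A)(R a := R b)))"
  by (subst exec.simps) auto

lemma exec_Seq_iff:
  "exec w (Seq P P') s t s' \<longleftrightarrow>
     (\<exists>t1 s1 t2. exec w P s t1 s1 \<and> exec w P' s1 t2 s' \<and> t = t1 + t2)"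
  by (subst exec.simps) auto

lemma exec_Cond_iff:
  "exec w (Cond r P P') (R, M) t s' \<longleftrightarrow>
     (\<exists>t'. exec w (if R r \<noteq> 0 then P else P') (R, M) t' s' \<and> t = 1 + t')"
  by (subst exec.simps) auto

lemma exec_While_iff:
  "exec w (While r P) (R, M) t s' \<longleftrightarrow>
     (if R r \<noteq> 0
      then \<exists>t1 s1 t2. exec w P (R, M) t1 s1 \<and> exec w (While r P) s1 t2 s' \<and> t = 1 + t1 + t2
      else t = 1 \<and> s' = (R, M))"
  by (subst exec.simps) auto

lemma terminates_mono:
  assumes "terminates w P s Q" and "\<And>t s'. Q t s' \<Longrightarrow> Q' t s'"
  shows "terminates w P s Q'"
  using assms unfolding terminates_def by blast

lemma terminates_Skip [simp]: "terminates w Skip s Q \<longleftrightarrow> Q 1 s"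
  unfolding terminates_def by (auto simp: exec_Skip_iff simp del: One_nat_def)

lemma terminates_Const [simp]:
  "terminates w (Const r k) (R, M) Q \<longleftrightarrow> k < 2 ^ w \<and> Q 1 (R(r := k), M)"
  unfolding terminates_def by (auto simp: exec_Const_iff simp del: One_nat_def)

lemma terminates_Op [simp]:
  "terminates w (Op f r a b) (R, M) Q \<longleftrightarrow> eval_binop f (R a) (R b) < 2 ^ w \<and>
     Q 1 (R(r := eval_binop f (R a) (R b)), M)"
  unfolding terminates_def by (auto simp: exec_Op_iff simp del: One_nat_def)

lemma terminates_Load [simp]:
  "terminates w (Load r A a) (R, M) Q \<longleftrightarrow> Q 1 (R(r := M A (R a)), M)"
  unfolding terminates_def by (auto simp: exec_Load_iff simp del: One_nat_def)

lemma terminates_Store [simp]: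
  "terminates w (Store A a b) (R, M) Q \<longleftrightarrow> Q 1 (R, M(A := (M A)(R a := R b)))"
  unfolding terminates_def by (auto simp: exec_Store_iff simp del: One_nat_def)

lemma terminates_Seq [simp]:
  "terminates w (Seq P P') s Q \<longleftrightarrow>
     terminates w P s (\<lambda>t s'. terminates w P' s' (\<lambda>t'. Q (t + t')))"
  unfolding terminates_def exec_Seq_iff by blast

lemma terminates_Cond [simp]:
  "terminates w (Cond r P P') (R, M) Q \<longleftrightarrow>
     (if R r \<noteq> 0 then terminates w P (R, M) (\<lambda>t. Q (1 + t))
      else terminates w P' (R, M) (\<lambda>t. Q (1 + t)))"
  unfolding terminates_def exec_Cond_iff by (cases "R r = 0") (simp_all del: One_nat_def, blast+)

text \<open>Kept out of the simp set because the right-hand side contains the loop again; each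
  induction step unfolds it once.\<close>

lemma terminates_While:
  "terminates w (While r P) (R, M) Q \<longleftrightarrow>
     (if R r \<noteq> 0
      then terminates w P (R, M)
        (\<lambda>t s. terminates w (While r P) s (\<lambda>t'. Q (1 + t + t')))
      else Q 1 (R, M))"
proof (cases "R r = 0")
  case True
  then show ?thesis
    unfolding terminates_def by (simp add: exec_While_iff del: One_nat_def)
next
  case False
  have "(\<exists>t s'. exec w (While r P) (R, M) t s' \<and> Q t s') \<longleftrightarrow>
      (\<exists>t s'. (\<exists>t1 s1 t2. exec w P (R, M) t1 s1 \<and> exec w (While r P) s1 t2 s' \<and>
         t = 1 + t1 + t2) \<and> Q t s')"
    by (subst exec_While_iff) (simp only: False if_True not_False_eq_True)
  also have "\<dots> \<longleftrightarrow> (\<exists>t s'. exec w P (R, M) t s' \<and>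
      (\<exists>t' s''. exec w (While r P) s' t' s'' \<and> Q (1 + t + t') s''))"
    by blast
  finally show ?thesis
    using False unfolding terminates_def by simp
qed

text \<open>The word length enters only through upper bounds on results, so a longer word allows the
  same run. This lets the solver run with the word length of the surrounding program.\<close>

lemma exec_mono_word: "exec w P s t s' \<Longrightarrow> w \<le> w' \<Longrightarrow> exec w' P s t s'"
proof (induction rule: exec.induct)
  case (Const k r R M)
  then show ?case by (meson exec.Const less_le_trans power_increasing one_le_numeral)
next
  case (Op f R a b r M)
  then show ?case by (meson exec.Op less_le_trans power_increasing one_le_numeral)
qed (auto simp del: One_nat_def neq0_conv intro: exec.intros)

text \<open>
  Renaming the registers and arrays of a program by an offset lets it run as a subroutine: its initial
  state requires everything except its input to be 0, and the part below the offset is not touched.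
\<close>

primrec shift_program :: "nat \<Rightarrow> program \<Rightarrow> program" where
  "shift_program d Skip = Skip"
| "shift_program d (Const r k) = Const (r + d) k"
| "shift_program d (Op f r a b) = Op f (r + d) (a + d) (b + d)"
| "shift_program d (Load r A a) = Load (r + d) (A + d) (a + d)"
| "shift_program d (Store A a b) = Store (A + d) (a + d) (b + d)"
| "shift_program d (Seq P Q) = Seq (shift_program d P) (shift_program d Q)"
| "shift_program d (Cond r P Q) = Cond (r + d) (shift_program d P) (shift_program d Q)"
| "shift_program d (While r P) = While (r + d) (shift_program d P)"

definition overlay :: "nat \<Rightarrow> (nat \<Rightarrow> 'a) \<Rightarrow> (nat \<Rightarrow> 'a) \<Rightarrow> nat \<Rightarrow> 'a" where
  "overlay d f g i = (if i < d then f i else g (i - d))"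

lemma overlay_add [simp]: "overlay d f g (i + d) = g i"
  by (simp add: overlay_def)

lemma overlay_upd [simp]: "(overlay d f g)(i + d := y) = overlay d f (g(i := y))"
  by (auto simp: overlay_def fun_eq_iff)

lemma exec_shift_program:
  assumes "exec w P (R, M) t (R', M')"
  shows "exec w (shift_program d P) (overlay d S R, overlay d L M) t
           (overlay d S R', overlay d L M')"
proof -
  \<comment> \<open>Projections replace the pairs so that both states are variables in the rule
    induction.\<close>
  have "exec w (shift_program d P) (overlay d S (fst s), overlay d L (snd s)) t
      (overlay d S (fst s'), overlay d L (snd s'))" if "exec w P s t s'" for s s'
    using that
  proof (induction rule: exec.induct)
    case (Const k r R M)
    then show ?case
      using exec.Const[of k w "r + d" "overlay d S R" "overlay d L M"] by (simp del: fun_upd_apply)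
  next
    case (Op f R a b r M)
    then show ?case
      using exec.Op[of f "overlay d S R" "a + d" "b + d" w "r + d"] by (simp del: fun_upd_apply)
  next
    case (Load r A a R M)
    then show ?case
      using exec.Load[of w "r + d" "A + d" "a + d" "overlay d S R" "overlay d L M"] by (simp del: fun_upd_apply)
  next
    case (Store A a b R M)
    then show ?case
      using exec.Store[of w "A + d" "a + d" "b + d" "overlay d S R" "overlay d L M"] by (simp del: fun_upd_apply)
  next
    case (CondTrue R r P M t s' Q)
    then show ?case
      using exec.CondTrue[of "overlay d S R" "r + d" w "shift_program d P" "overlay d L M"] by simp
  next
    case (CondFalse R r Q M t s' P)
    then show ?case
      using exec.CondFalse[of "overlay d S R" "r + d" w "shift_program d Q" "overlay d L M"] by simp
  qed (auto simp del: One_nat_def neq0_conv intro: exec.intros)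
  from this[OF assms] show ?thesis by simp
qed

text \<open>The closing \<open>Skip\<close> costs one step, which the step counts below
  include.\<close>

primrec block :: "program list \<Rightarrow> program" where
  "block [] = Skip"
| "block (P # Ps) = Seq P (block Ps)"

section \<open>The reduction graph\<close>

text \<open>Assignments are numbers read bitwise, so that a program can evaluate a literal by a
  shift and a parity test.\<close>

definition sat_low :: "nat \<Rightarrow> nat \<Rightarrow> clause \<Rightarrow> bool" where
  "sat_low h a C \<longleftrightarrow> (\<exists>(x, b)\<in>set C. x < h \<and> bit a x = b)"

definition sat_high :: "nat \<Rightarrow> nat \<Rightarrow> clause \<Rightarrow> bool" where
  "sat_high h a C \<longleftrightarrow> (\<exists>(x, b)\<in>set C. h \<le> x \<and> bit a (x - h) = b)"

text \<open>
  With \<open>H = 2 ^ h\<close>, the vertices are numbered as follows: \<open>a < H\<close> is an assignment to the variables below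
  \<open>h\<close>, \<open>H + a\<close> an assignment to the others, and the \<open>i\<close>-th clause owns \<open>c = 2 * H + 2 * i\<close> and
  \<open>d = c + 1\<close>. The \<open>Nil\<close> case adds a clause that is always satisfied; it keeps the
  maximum attained at a pair \<open>(a, H + b)\<close> even if no clause of the formula can be satisfied.
\<close>

primrec clause_edges :: "nat \<Rightarrow> nat \<Rightarrow> nat \<Rightarrow> clause list \<Rightarrow> (nat \<times> nat) list" where
  "clause_edges h a i [] = [(a, 2 * 2 ^ h + 2 * i), (2 * 2 ^ h + 2 * i, 2 ^ h + a)]"
| "clause_edges h a i (C # F) =
     [(a, 2 * 2 ^ h + 2 * i + of_bool (\<not> sat_low h a C)), (2 * 2 ^ h + 2 * i, 2 ^ h + a)] @
     (if sat_high h a C then [(2 * 2 ^ h + 2 * i + 1, 2 ^ h + a)] else []) @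
     clause_edges h a (Suc i) F"

primrec edges_below :: "nat \<Rightarrow> clause list \<Rightarrow> nat \<Rightarrow> (nat \<times> nat) list" where
  "edges_below h F 0 = []"
| "edges_below h F (Suc a) = clause_edges h a 0 F @ edges_below h F a"

text \<open>Rounding up lets the variables from \<open>half n\<close> on fit into
  \<open>half n\<close> bits as well; for odd \<open>n\<close> the top bit of the second number is
  ignored.\<close>

definition half :: "nat \<Rightarrow> nat" where
  "half n = (n + 1) div 2"

text \<open>
  Isolated vertices pad the graph until it has at least as many vertices as edges. Hence
  the number of clauses needs no bound, and no sparsification is needed to refute \<open>SETH\<close>.
\<close>

definition sat_graph :: "cnf \<Rightarrow> nat \<times> (nat \<times> nat) list" where
  "sat_graph = (\<lambda>(n, F). (4 * 2 ^ half n * (length F + 1), edges_below (half n) F (2 ^ half n)))"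

section \<open>Size, layers and distinctness of the edge list\<close>

lemma length_clause_edges: "length (clause_edges h a i F) \<le> 3 * length F + 2"
proof (induction F arbitrary: i)
  case (Cons C F)
  show ?case using Cons[of "Suc i"] by simp
qed simp

lemma length_edges_below: "length (edges_below h F k) \<le> k * (3 * length F + 2)"
proof (induction k)
  case (Suc k)
  then show ?case using length_clause_edges[of h k 0 F] by simp
qed simp

text \<open>An edge of row \<open>a\<close> has a clause vertex at one end and, at the other,
  \<open>a\<close> as tail or \<open>2 ^ h + a\<close> as head. The clause ranges separate the edges
  of different clauses and \<open>a\<close> separates the rows, which yields distinctness and the
  layers of the graph.\<close>

lemma clause_edges_cases:
  assumes "(u, v) \<in> set (clause_edges h a i F)"
  shows "u = a \<and> 2 * 2 ^ h + 2 * i \<le> v \<and> v < 2 * 2 ^ h + 2 * (i + length F + 1) \<or>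
    v = 2 ^ h + a \<and> 2 * 2 ^ h + 2 * i \<le> u \<and> u < 2 * 2 ^ h + 2 * (i + length F + 1)"
  using assms by (induction F arbitrary: i) (fastforce split: if_splits)+

lemma edges_below_iff: "e \<in> set (edges_below h F k) \<longleftrightarrow> (\<exists>a<k. e \<in> set (clause_edges h a 0 F))"
  by (induction k) (auto simp: less_Suc_eq)

lemma edges_below_cases:
  assumes "(u, v) \<in> set (edges_below h F k)" "k \<le> 2 ^ h"
  shows "u < k \<and> 2 * 2 ^ h \<le> v \<and> v < 2 * 2 ^ h + 2 * (length F + 1) \<or>
    2 ^ h \<le> v \<and> v < 2 ^ h + k \<and> 2 * 2 ^ h \<le> u \<and> u < 2 * 2 ^ h + 2 * (length F + 1)"
  using assms clause_edges_cases[of u v h _ 0 F] unfolding edges_below_iff by force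

lemma distinct_clause_edges:
  assumes "a < 2 ^ h"
  shows "distinct (clause_edges h a i F)"
proof (induction F arbitrary: i)
  case Nil
  then show ?case using assms by auto
next
  case (Cons C F)
  then show ?case
    using assms by (auto dest!: clause_edges_cases split: if_splits simp: of_bool_def)
qed

lemma distinct_edges_below: "k \<le> 2 ^ h \<Longrightarrow> distinct (edges_below h F k)"
proof (induction k)
  case (Suc k)
  have "set (clause_edges h k 0 F) \<inter> set (edges_below h F k) = {}"
  proof safe
    fix u v
    assume "(u, v) \<in> set (clause_edges h k 0 F)" "(u, v) \<in> set (edges_below h F k)"
    with clause_edges_cases[OF this(1)] edges_below_cases[OF this(2)] Suc.prems
    show "(u, v) \<in> {}" by auto
  qed
  with Suc show ?case by (simp add: distinct_clause_edges)
qed simp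

lemma ex_le_Suc_iff: "(\<exists>j\<le>Suc n. P j) \<longleftrightarrow> P 0 \<or> (\<exists>j\<le>n. P (Suc j))"
  by (metis Suc_le_mono not0_implies_Suc zero_le)

text \<open>The index \<open>j = length F\<close> stands for the added clause; the guard
  \<open>j < length F\<close> assigns it the even vertex, the one for satisfied clauses.\<close>

lemma clause_edges_from_iff:
  assumes "a < 2 ^ h"
  shows "(a, v) \<in> set (clause_edges h a i F) \<longleftrightarrow>
    (\<exists>j\<le>length F. v = 2 * 2 ^ h + 2 * (i + j) + of_bool (j < length F \<and> \<not> sat_low h a (F ! j)))"
    (is "_ \<longleftrightarrow> (\<exists>j\<le>_. ?P i F j)")
proof (induction F arbitrary: i)
  case Nil
  then show ?case using assms by simp
next
  case (Cons C F)
  have "(a, v) \<in> set (clause_edges h a i (C # F)) \<longleftrightarrow>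
      ?P i (C # F) 0 \<or> (a, v) \<in> set (clause_edges h a (Suc i) F)"
    using assms by simp
  also have "\<dots> \<longleftrightarrow> ?P i (C # F) 0 \<or> (\<exists>j\<le>length F. ?P i (C # F) (Suc j))"
    unfolding Cons by simp
  also have "\<dots> \<longleftrightarrow> (\<exists>j\<le>Suc (length F). ?P i (C # F) j)"
    by (rule ex_le_Suc_iff[symmetric])
  finally show ?case by simp
qed

lemma clause_edges_to_iff:
  assumes "a < 2 ^ h"
  shows "(u, 2 ^ h + a) \<in> set (clause_edges h a i F) \<longleftrightarrow>
    (\<exists>j\<le>length F. u = 2 * 2 ^ h + 2 * (i + j) \<or>
      j < length F \<and> sat_high h a (F ! j) \<and> u = 2 * 2 ^ h + 2 * (i + j) + 1)"
    (is "_ \<longleftrightarrow> (\<exists>j\<le>_. ?P i F j)")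
proof (induction F arbitrary: i)
  case Nil
  then show ?case using assms by simp
next
  case (Cons C F)
  have "(u, 2 ^ h + a) \<in> set (clause_edges h a i (C # F)) \<longleftrightarrow>
      ?P i (C # F) 0 \<or> (u, 2 ^ h + a) \<in> set (clause_edges h a (Suc i) F)"
    using assms by auto
  also have "\<dots> \<longleftrightarrow> ?P i (C # F) 0 \<or> (\<exists>j\<le>length F. ?P i (C # F) (Suc j))"
    unfolding Cons by simp
  also have "\<dots> \<longleftrightarrow> (\<exists>j\<le>Suc (length F). ?P i (C # F) j)"
    by (rule ex_le_Suc_iff[symmetric])
  finally show ?case by simp
qed

text \<open>Tails in the other rows are different assignments or clause vertices, so only row
  \<open>a\<close> contributes.\<close>

lemma edges_from_iff:
  assumes "a < 2 ^ h"
  shows "(a, v) \<in> set (edges_below h F (2 ^ h)) \<longleftrightarrow>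
    (\<exists>j\<le>length F. v = 2 * 2 ^ h + 2 * j + of_bool (j < length F \<and> \<not> sat_low h a (F ! j)))"
proof -
  have "(a, v) \<in> set (edges_below h F (2 ^ h)) \<longleftrightarrow> (a, v) \<in> set (clause_edges h a 0 F)"
    unfolding edges_below_iff using assms clause_edges_cases[of a v h _ 0 F] by fastforce
  then show ?thesis using clause_edges_from_iff[OF assms, of v 0 F] by simp
qed

lemma edges_to_iff:
  assumes "b < 2 ^ h"
  shows "(u, 2 ^ h + b) \<in> set (edges_below h F (2 ^ h)) \<longleftrightarrow>
    (\<exists>j\<le>length F. u = 2 * 2 ^ h + 2 * j \<or>
      j < length F \<and> sat_high h b (F ! j) \<and> u = 2 * 2 ^ h + 2 * j + 1)"
proof -
  have "(u, 2 ^ h + b) \<in> set (edges_below h F (2 ^ h)) \<longleftrightarrow>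
      (u, 2 ^ h + b) \<in> set (clause_edges h b 0 F)"
    unfolding edges_below_iff using assms clause_edges_cases[of u "2 ^ h + b" h _ 0 F] by fastforce
  then show ?thesis using clause_edges_to_iff[OF assms, of u 0 F] by simp
qed

lemma is_digraph_sat_graph: "is_digraph (sat_graph (n, F))"
proof -
  let ?h = "half n"
  have bound: "2 * 2 ^ ?h + 2 * (length F + 1) \<le> 4 * 2 ^ ?h * (length F + 1)"
  proof -
    have "1 * (length F + 1) \<le> 2 ^ ?h * (length F + 1)" by (rule mult_right_mono) auto
    then show ?thesis by (simp add: algebra_simps)
  qed
  have "u < 4 * 2 ^ ?h * (length F + 1) \<and> v < 4 * 2 ^ ?h * (length F + 1) \<and> u \<noteq> v"
    if "(u, v) \<in> set (edges_below ?h F (2 ^ ?h))" for u v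
    using edges_below_cases[OF that order_refl] bound by linarith
  then have "digraph (digraph_of (sat_graph (n, F)))"
    by unfold_locales (auto simp: digraph_of_def sat_graph_def arc_to_ends_def)
  then show ?thesis
    by (simp add: is_digraph_def sat_graph_def distinct_edges_below)
qed

lemma length_sat_graph: "length (snd (sat_graph (n, F))) \<le> fst (sat_graph (n, F))"
  using length_edges_below[of "half n" F "2 ^ half n"]
  by (simp add: sat_graph_def algebra_simps)

section \<open>Assignments as pairs of bit patterns\<close>

lemma ex_bits: "\<exists>a<2 ^ h. \<forall>x<h. bit (a :: nat) x = f x"
proof (intro exI conjI allI impI)
  let ?a = "horner_sum of_bool 2 (map f [0..<h]) :: nat"
  show "?a < 2 ^ h" using horner_sum_of_bool_2_less[of "map f [0..<h]", where ?'a = nat] by simp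
  show "bit ?a x = f x" if "x < h" for x
    using that by (simp add: bit_horner_sum_bit_iff)
qed

text \<open>Positions are counted rather than clauses, because a formula may repeat a
  clause.\<close>

definition count_sat :: "cnf \<Rightarrow> nat \<Rightarrow> nat \<Rightarrow> nat" where
  "count_sat = (\<lambda>(n, F) a b. card {j. j < length F \<and> (sat_low (half n) a (F ! j) \<or> sat_high (half n) b (F ! j))})"

lemma count_sat_eq:
  assumes "\<And>x. x < half n \<Longrightarrow> \<sigma> x = bit a x"
    and "\<And>x. half n \<le> x \<Longrightarrow> x < n \<Longrightarrow> \<sigma> x = bit b (x - half n)"
    and "is_cnf (n, F)"
  shows "count_sat (n, F) a b = length (filter (satisfies \<sigma>) F)"
proof -
  have *: "satisfies \<sigma> C \<longleftrightarrow> sat_low (half n) a C \<or> sat_high (half n) b C" if "C \<in> set F" for C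
  proof -
    have "(case l of (x, c) \<Rightarrow> \<sigma> x = c) \<longleftrightarrow> (case l of (x, c) \<Rightarrow> x < half n \<and> bit a x = c) \<or>
        (case l of (x, c) \<Rightarrow> half n \<le> x \<and> bit b (x - half n) = c)" if "l \<in> set C" for l
    proof (cases l)
      case (Pair x c)
      then have "x < n" using that \<open>C \<in> set F\<close> assms(3) by (auto simp: is_cnf_def)
      then show ?thesis
        using assms(1)[of x] assms(2)[of x] Pair by (cases "x < half n") (simp_all add: not_less)
    qed
    then show ?thesis
      unfolding satisfies_def sat_low_def sat_high_def bex_disj_distrib[symmetric]
      by (rule bex_cong[OF refl])
  qed
  have "{j. j < length F \<and> (sat_low (half n) a (F ! j) \<or> sat_high (half n) b (F ! j))} =
      {j. j < length F \<and> satisfies \<sigma> (F ! j)}"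
    by (simp add: * cong: conj_cong)
  then show ?thesis
    unfolding count_sat_def length_filter_conv_card by simp
qed

lemma max_sat_eq:
  assumes "is_cnf (n, F)"
  shows "max_sat (n, F) = Max {count_sat (n, F) a b |a b. a < 2 ^ half n \<and> b < 2 ^ half n}"
proof -
  have "{length (filter (satisfies \<sigma>) F) |\<sigma>. True} =
      {count_sat (n, F) a b |a b. a < 2 ^ half n \<and> b < 2 ^ half n}" (is "?A = ?B")
  proof (intro equalityI subsetI)
    fix y assume "y \<in> ?A"
    then obtain \<sigma> where y: "y = length (filter (satisfies \<sigma>) F)" by blast
    obtain a :: nat where a: "a < 2 ^ half n" "\<forall>x<half n. bit a x = \<sigma> x"
      using ex_bits[of "half n" \<sigma>] by auto
    obtain b :: nat where b: "b < 2 ^ half n" "\<forall>x<half n. bit b x = \<sigma> (x + half n)"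
      using ex_bits[of "half n" "\<lambda>x. \<sigma> (x + half n)"] by auto
    have high: "\<sigma> x = bit b (x - half n)" if "half n \<le> x" "x < n" for x
    proof -
      \<comment> \<open>This is where \<open>half\<close> has to round up.\<close>
      have "x - half n < half n" using that by (auto simp: half_def)
      then show ?thesis using b(2) that by simp
    qed
    have "count_sat (n, F) a b = y"
      unfolding y by (rule count_sat_eq[OF _ high assms]) (use a(2) in auto)
    then show "y \<in> ?B" using a(1) b(1) by blast
  next
    fix y assume "y \<in> ?B"
    then obtain a b where y: "y = count_sat (n, F) a b" by blast
    have "y = length (filter (satisfies (\<lambda>x. if x < half n then bit a x else bit b (x - half n))) F)"
      unfolding y by (rule count_sat_eq[OF _ _ assms]) auto
    then show "y \<in> ?A" by blast
  qed
  then show ?thesis by (simp add: max_sat_def)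
qed

section \<open>Local edge connectivity in the reduction graph\<close>

context
  fixes n :: nat and F :: "clause list" and G h
  defines "G \<equiv> digraph_of (sat_graph (n, F))" and "h \<equiv> half n"
begin

text \<open>Edges lead from sources to clause vertices or from clause vertices to sinks, and no edge
  leaves a sink. Hence no walk has three edges, and one with two edges joins a source to a
  sink.\<close>

lemma sat_graph_walk:
  assumes "pre_digraph.awalk G u p v" "u \<noteq> v"
  shows "p = [(u, v)] \<or> (\<exists>x. p = [(u, x), (x, v)] \<and> u < 2 ^ h \<and> 2 ^ h \<le> v \<and> v < 2 * 2 ^ h)"
proof -
  have cas: "pre_digraph.cas G u p v" and arcs: "set p \<subseteq> set (edges_below h F (2 ^ h))"
    using assms unfolding pre_digraph.awalk_def
    by (auto simp: G_def h_def digraph_of_def sat_graph_def)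
  note simps = pre_digraph.cas.simps G_def digraph_of_def sat_graph_def
  have E: "x < 2 ^ h \<and> 2 * 2 ^ h \<le> y \<or> 2 ^ h \<le> y \<and> y < 2 * 2 ^ h \<and> 2 * 2 ^ h \<le> x"
    if "(x, y) \<in> set p" for x y
    using edges_below_cases[of x y h F "2 ^ h"] that arcs by auto
  consider "p = []" | e where "p = [e]" | e e' where "p = [e, e']"
    | e e' e'' q where "p = e # e' # e'' # q"
    by (metis list.exhaust)
  then show ?thesis
  proof cases
    case 1
    then show ?thesis using cas assms(2) by (simp add: simps)
  next
    case (2 e)
    then show ?thesis using cas by (cases e) (auto simp add: simps)
  next
    case (3 e e')
    then show ?thesis using cas E[of "fst e" "snd e"] E[of "fst e'" "snd e'"]
      by (cases e; cases e') (auto simp: simps)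
  next
    case (4 e e' e'' q)
    then show ?thesis
      using cas E[of "fst e" "snd e"] E[of "fst e'" "snd e'"] E[of "fst e''" "snd e''"]
      by (cases e; cases e'; cases e'') (auto simp: simps)
  qed
qed

text \<open>A path of length 2 would join a source to a sink, so the single edge
  \<open>(u, v)\<close> is the only possible path.\<close>

lemma local_edge_connectivity_le_1:
  assumes "u \<noteq> v" "\<not> (u < 2 ^ h \<and> 2 ^ h \<le> v \<and> v < 2 * 2 ^ h)"
  shows "local_edge_connectivity G u v \<le> 1"
proof -
  let ?S = "{card P |P. (\<forall>p\<in>P. pre_digraph.apath G u p v) \<and>
    (\<forall>p\<in>P. \<forall>q\<in>P. p \<noteq> q \<longrightarrow> set p \<inter> set q = {})}"
  have le: "k \<le> 1" if "k \<in> ?S" for k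
  proof -
    from that obtain P where P: "k = card P" "\<forall>p\<in>P. pre_digraph.apath G u p v" by blast
    have "P \<subseteq> {[(u, v)]}"
      using P(2) sat_graph_walk[OF _ assms(1)] assms(2) unfolding pre_digraph.apath_def by blast
    then have "card P \<le> card {[(u, v)]}" by (intro card_mono) auto
    then show ?thesis using P by simp
  qed
  \<comment> \<open>\<open>Max\<close> is meaningful only on finite nonempty sets: the bound gives
    finiteness, and the empty family gives an element.\<close>
  have "finite ?S" by (rule finite_subset[of _ "{..1}"]) (use le in auto)
  moreover have "card {} \<in> ?S" by (rule CollectI, rule exI[of _ "{}"]) simp
  ultimately show ?thesis using le unfolding local_edge_connectivity_def by (subst Max_le_iff) auto
qed

text \<open>The middle vertex determines a path, and both of its edges contain this vertex, so the
  set \<open>Ps\<close> of all paths is itself edge-disjoint and no smaller family can beat it. The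
  summand 1 is the path through the added clause.\<close>

lemma local_edge_connectivity_assignments:
  assumes "a < 2 ^ h" "b < 2 ^ h"
  shows "local_edge_connectivity G a (2 ^ h + b) = count_sat (n, F) a b + 1"
proof -
  let ?m = "length F"
  define x where "x j = 2 * 2 ^ h + 2 * j + of_bool (j < ?m \<and> \<not> sat_low h a (F ! j))" for j
  define path where "path j = [(a, x j), (x j, 2 ^ h + b)]" for j
  define J where "J = {j. j < ?m \<and> (sat_low h a (F ! j) \<or> sat_high h b (F ! j))}"
  define Ps where "Ps = {p. pre_digraph.apath G a p (2 ^ h + b)}"
  have parity: "2 * p + 2 * j + of_bool c = 2 * p + 2 * i + of_bool d \<longleftrightarrow> i = j \<and> c = d"
    for p i j :: nat and c d
    by (cases c; cases d; simp; presburger?)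
  have x_inj: "x i = x j \<longleftrightarrow> i = j" for i j
    unfolding x_def parity by auto
  have x_ge: "2 * 2 ^ h \<le> x j" for j by (simp add: x_def)
  have from_iff: "(a, v) \<in> set (edges_below h F (2 ^ h)) \<longleftrightarrow> (\<exists>j\<le>?m. v = x j)" for v
    using edges_from_iff[OF assms(1), of v F] by (simp add: x_def)
  \<comment> \<open>An even \<open>x j\<close> is joined to every sink. An odd one means that
    \<open>a\<close> fails the clause, and then \<open>b\<close> has to satisfy it.\<close>
  have to_iff: "(x j, 2 ^ h + b) \<in> set (edges_below h F (2 ^ h)) \<longleftrightarrow> j \<in> insert ?m J"
    if "j \<le> ?m" for j
  proof -
    have "x j = 2 * 2 ^ h + 2 * i \<longleftrightarrow> i = j \<and> \<not> (j < ?m \<and> \<not> sat_low h a (F ! j))"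
      "x j = 2 * 2 ^ h + 2 * i + 1 \<longleftrightarrow> i = j \<and> j < ?m \<and> \<not> sat_low h a (F ! j)" for i
      using parity[of "2 ^ h" j _ i False] parity[of "2 ^ h" j _ i True] by (auto simp: x_def)
    then have "(x j, 2 ^ h + b) \<in> set (edges_below h F (2 ^ h)) \<longleftrightarrow>
        \<not> (j < ?m \<and> \<not> sat_low h a (F ! j)) \<or> j < ?m \<and> sat_high h b (F ! j)"
      unfolding edges_to_iff[OF assms(2)] using that by auto
    then show ?thesis using that by (auto simp: J_def)
  qed
  have Ps: "Ps = path ` insert ?m J"
  proof (intro equalityI subsetI)
    fix p assume "p \<in> Ps"
    then have walk: "pre_digraph.awalk G a p (2 ^ h + b)"
      by (simp add: Ps_def pre_digraph.apath_def)
    then have arcs: "set p \<subseteq> set (edges_below h F (2 ^ h))"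
      unfolding pre_digraph.awalk_def by (auto simp: G_def h_def digraph_of_def sat_graph_def)
    have "a \<noteq> 2 ^ h + b" using assms by auto
    from sat_graph_walk[OF walk this] obtain y
      where "p = [(a, 2 ^ h + b)] \<or> p = [(a, y), (y, 2 ^ h + b)]" by blast
    moreover have "(a, 2 ^ h + b) \<notin> set (edges_below h F (2 ^ h))"
      using edges_below_cases[of a "2 ^ h + b" h F "2 ^ h"] assms by auto
    ultimately have p: "p = [(a, y), (y, 2 ^ h + b)]" using arcs by auto
    then obtain j where "j \<le> ?m" "y = x j" using arcs from_iff by auto
    then show "p \<in> path ` insert ?m J" using p arcs to_iff[of j] by (auto simp: path_def)
  next
    fix p assume "p \<in> path ` insert ?m J"
    then obtain j where p: "p = path j" and j: "j \<in> insert ?m J" by blast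
    then have "j \<le> ?m" by (auto simp: J_def)
    then have "set p \<subseteq> set (edges_below h F (2 ^ h))"
      using to_iff[of j] from_iff[of "x j"] j by (auto simp: p path_def)
    moreover have "a < 4 * 2 ^ h * (?m + 1)"
      using assms by (simp add: algebra_simps)
    ultimately show "p \<in> Ps"
      using assms x_ge[of j]
      by (auto simp: Ps_def pre_digraph.apath_def pre_digraph.awalk_def pre_digraph.cas.simps
          pre_digraph.awalk_verts.simps G_def digraph_of_def sat_graph_def h_def p path_def)
  qed
  have "inj_on path (insert ?m J)"
    by (auto simp: inj_on_def path_def x_inj)
  moreover have "finite J" "?m \<notin> J" by (auto simp: J_def)
  ultimately have card: "card Ps = card J + 1" and fin: "finite Ps"
    unfolding Ps by (simp_all add: card_image)
  have disj: "\<forall>p\<in>Ps. \<forall>q\<in>Ps. p \<noteq> q \<longrightarrow> set p \<inter> set q = {}"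
  proof -
    have "a \<noteq> x j" "x j \<noteq> 2 ^ h + b" for j
      using assms x_ge[of j] by auto
    then show ?thesis unfolding Ps by (auto simp: path_def x_inj)
  qed
  have "local_edge_connectivity G a (2 ^ h + b) = card Ps"
    unfolding local_edge_connectivity_def
  proof (rule Max_eqI)
    let ?S = "{card P |P. (\<forall>p\<in>P. pre_digraph.apath G a p (2 ^ h + b)) \<and>
      (\<forall>p\<in>P. \<forall>q\<in>P. p \<noteq> q \<longrightarrow> set p \<inter> set q = {})}"
    show le: "k \<le> card Ps" if "k \<in> ?S" for k
      using that fin by (auto simp: Ps_def intro: card_mono)
    show "finite ?S" by (rule finite_subset[of _ "{..card Ps}"]) (use le in auto)
    show "card Ps \<in> ?S" using disj unfolding Ps_def by blast
  qed
  then show ?thesis using card by (simp add: count_sat_def J_def h_def)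
qed

lemma max_local_edge_connectivity_sat_graph:
  assumes "is_cnf (n, F)"
  shows "max_local_edge_connectivity G = max_sat (n, F) + 1"
proof -
  let ?S = "{count_sat (n, F) a b |a b. a < 2 ^ half n \<and> b < 2 ^ half n}"
  let ?L = "{local_edge_connectivity G u v |u v. u \<in> verts G \<and> v \<in> verts G \<and> u \<noteq> v}"
  have "?S = (\<lambda>(a, b). count_sat (n, F) a b) ` ({..<2 ^ half n} \<times> {..<2 ^ half n})" by auto
  then have fin: "finite ?S" by simp
  have "count_sat (n, F) 0 0 \<in> ?S" by fastforce
  then have "Max ?S \<in> ?S" using Max_in[OF fin] by blast
  then obtain a b where ab: "a < 2 ^ half n" "b < 2 ^ half n" "Max ?S = count_sat (n, F) a b" by auto
  have verts: "verts G = {..<4 * 2 ^ half n * (length F + 1)}"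
    by (simp add: G_def digraph_of_def sat_graph_def)
  have "Max (insert 0 ?L) = Max ?S + 1"
  proof (rule Max_eqI)
    have "?L = (\<lambda>(u, v). local_edge_connectivity G u v) ` ((verts G \<times> verts G) - Id)" by auto
    then show "finite (insert 0 ?L)" using verts by simp
    show "k \<le> Max ?S + 1" if "k \<in> insert 0 ?L" for k
    proof -
      have "local_edge_connectivity G u v \<le> Max ?S + 1" if "u \<noteq> v" for u v
      proof (cases "u < 2 ^ h \<and> 2 ^ h \<le> v \<and> v < 2 * 2 ^ h")
        case True
        then have v: "v - 2 ^ h < 2 ^ h" "2 ^ h + (v - 2 ^ h) = v" by auto
        then have "local_edge_connectivity G u v = count_sat (n, F) u (v - 2 ^ h) + 1"
          using local_edge_connectivity_assignments[of u "v - 2 ^ h"] True v by auto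
        moreover have "count_sat (n, F) u (v - 2 ^ h) \<le> Max ?S"
          using fin True v by (intro Max_ge) (auto simp: h_def)
        ultimately show ?thesis by simp
      next
        case False
        \<comment> \<open>The added clause matters here: the value 1 of other pairs stays below
          \<open>Max ?S + 1\<close> even if \<open>Max ?S = 0\<close>.\<close>
        then show ?thesis using local_edge_connectivity_le_1[OF that] by fastforce
      qed
      then show ?thesis using that by auto
    qed
    have "a < 4 * 2 ^ half n * (length F + 1)" "2 ^ half n + b < 4 * 2 ^ half n * (length F + 1)"
      using ab by (auto simp: algebra_simps)
    moreover have "Max ?S + 1 = local_edge_connectivity G a (2 ^ half n + b)" "a \<noteq> 2 ^ half n + b"
      using local_edge_connectivity_assignments[of a b] ab by (auto simp: h_def)
    ultimately have "Max ?S + 1 \<in> ?L"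
      unfolding verts by (intro CollectI exI[of _ a] exI[of _ "2 ^ half n + b"]) auto
    then show "Max ?S + 1 \<in> insert 0 ?L" by simp
  qed
  then show ?thesis by (simp add: max_local_edge_connectivity_def max_sat_eq[OF assms])
qed

end

section \<open>Building the graph\<close>

text \<open>The default 0 agrees with \<open>init_state\<close> and makes appending an entry a
  single store at position \<open>length xs\<close>.\<close>

definition array_of :: "nat list \<Rightarrow> nat \<Rightarrow> nat" where
  "array_of xs i = (if i < length xs then xs ! i else 0)"

lemma array_of_snoc [simp]: "i = length xs \<Longrightarrow> (array_of xs)(i := y) = array_of (xs @ [y])"
  by (auto simp: array_of_def fun_eq_iff nth_append)

text \<open>Loop invariants describe the input position by the unread suffix
  \<open>drop i xs\<close>; reading one entry removes its head.\<close>

lemma array_of_drop: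
  assumes "drop i xs = y # ys"
  shows "array_of xs i = y" "drop (Suc i) xs = ys" "y \<in> set xs" "i < length xs"
proof -
  show i: "i < length xs" using assms by (metis drop_all list.distinct(1) not_le)
  then have "xs ! i = y" "drop (Suc i) xs = ys"
    using assms Cons_nth_drop_Suc[OF i] by auto
  then show "array_of xs i = y" "drop (Suc i) xs = ys" "y \<in> set xs"
    using i by (auto simp: array_of_def)
qed

definition flatten :: "(nat \<times> nat) list \<Rightarrow> nat list" where
  "flatten es = concat (map (\<lambda>(u, v). [u, v]) es)"

lemma flatten_simps [simp]:
  "flatten [] = []" "flatten ((u, v) # es) = u # v # flatten es"
  "flatten (es @ es') = flatten es @ flatten es'"
  by (simp_all add: flatten_def)

lemma length_flatten [simp]: "length (flatten es) = 2 * length es"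
  by (induction es) auto

definition enc_clause :: "clause \<Rightarrow> nat list" where
  "enc_clause C = length C # map (\<lambda>(x, b). 2 * x + of_bool b) C"

text \<open>
  Registers: 2 number of clauses plus 1, 3 number of clauses, 4 \<open>h\<close>, 5 \<open>2 ^ h\<close>, 6 \<open>a\<close>, 7 input position,
  8 remaining clauses, 9 current vertex \<open>c\<close>, 10 remaining literals, 11 and 12 whether the clause is
  satisfied by the lower resp. upper variables, 16 output position, 17 constant 2, 18 \<open>2 ^ h + a\<close>,
  19 constant 0, 20 constant 1. The graph is written to array 21, and its length to register 21, which
  become array and register 0 of the shifted solver.
\<close>

definition emit :: "reg \<Rightarrow> program" where
  "emit r = block [Store 21 16 r, Op Plus 16 16 20]"

definition literal_body :: program where
  "literal_body = block [
     Load 13 0 7, Op Plus 7 7 20, Op Minus 10 10 20,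
     Op Div 14 13 17, Op Mod 13 13 17, Op Less 15 14 4,
     Cond 15
       (block [Op ShiftR 14 6 14, Op Mod 14 14 17, Op Equal 14 14 13, Op Or 11 11 14])
       (block [Op Minus 14 14 4, Op ShiftR 14 6 14, Op Mod 14 14 17, Op Equal 14 14 13,
          Op Or 12 12 14])]"

text \<open>Register 13 becomes \<open>c\<close> plus 1 minus the lower flag, which selects
  \<open>c\<close> or \<open>d\<close> as head of the edge from \<open>a\<close>.\<close>

definition clause_body :: program where
  "clause_body = block [
     Load 10 0 7, Op Plus 7 7 20, Op Minus 8 8 20, Const 11 0, Const 12 0,
     While 10 literal_body,
     Op Minus 13 20 11, Op Plus 13 9 13,
     emit 6, emit 13, emit 9, emit 18,
     Cond 12 (block [Op Plus 13 9 20, emit 13, emit 18]) Skip,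
     Op Plus 9 9 17]"

text \<open>Every row rereads the formula from position 2, behind the two header entries. The last
  four outputs are the two edges of the added clause. Decrementing \<open>a\<close> first yields the
  order of \<open>edges_below\<close>.\<close>

definition row_body :: program where
  "row_body = block [
     Op Minus 6 6 20, Op Plus 18 5 6, Const 7 2, Op Plus 9 5 5, Op Plus 8 3 19,
     While 8 clause_body,
     emit 6, emit 9, emit 9, emit 18]"

text \<open>The number of edges is known only at the end, so entry 1 of the output is left open and
  filled in from the final output position.\<close>

definition build_graph :: program where
  "build_graph = block [
     Const 20 1, Const 17 2, Load 2 0 19, Load 3 0 20,
     Op Plus 4 2 20, Op Div 4 4 17, Op ShiftL 5 20 4,
     Op Plus 2 3 20, Op Times 13 5 2, Const 14 4, Op Times 13 13 14,
     Store 21 19 13, Const 16 2, Op Plus 6 5 19,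
     While 6 row_body,
     Op Minus 13 16 17, Op Div 13 13 17, Store 21 20 13, Op Plus 21 16 19]"

section \<open>Correctness and step counts of the builder, from the inner loop outwards\<close>

lemma or_of_bool [simp]: "Bit_Operations.or (of_bool p) (of_bool q :: nat) = of_bool (p \<or> q)"
  by (cases p; cases q) simp_all

lemma bounded_results [simp]:
  fixes a b B :: nat
  shows "a < B \<Longrightarrow> a - b < B" "a < B \<Longrightarrow> a div b < B" "a < B \<Longrightarrow> a mod b < B"
    "a < B \<Longrightarrow> drop_bit b a < B"
proof -
  show "a - b < B" "a div b < B" "a mod b < B" if "a < B"
    using that div_le_dividend[of a b] mod_less_eq_dividend[of a b] by linarith+
  show "drop_bit b a < B" if "a < B"
    using that div_le_dividend[of a "2 ^ b"] unfolding drop_bit_eq_div by (rule le_less_trans[rotated])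
qed

lemma drop_bit_mod_2_eq: "(drop_bit x a mod 2 = of_bool b) = (bit (a :: nat) x = b)"
  by (cases b) (auto simp: bit_iff_odd_drop_bit odd_iff_mod_2_eq_one even_iff_mod_2_eq_zero)

lemma two_less_word: "2 \<le> w \<Longrightarrow> (2 :: nat) < 2 ^ w"
  using power_increasing[of 2 w "2 :: nat"] by simp

lemma of_bool_less_word: "2 \<le> w \<Longrightarrow> of_bool p < (2 :: nat) ^ w"
  using two_less_word[of w] by (cases p) auto

lemma terminates_literal_body:
  assumes "2 \<le> w" "R 20 = 1" "R 17 = 2" "R 4 = h" "R 6 = a"
    and "M 0 (R 7) = 2 * x + of_bool b" "2 * x + of_bool b < 2 ^ w" "R 7 + 1 < 2 ^ w"
    and "R 10 = Suc l" "Suc l < 2 ^ w" "a < 2 ^ w"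
    and "R 11 = of_bool p" "R 12 = of_bool q"
  shows "terminates w literal_body (R, M) (\<lambda>t (R', M').
    t \<le> 20 \<and> M' = M \<and> R' 7 = R 7 + 1 \<and> R' 10 = l \<and>
    R' 11 = of_bool (p \<or> x < h \<and> bit a x = b) \<and>
    R' 12 = of_bool (q \<or> h \<le> x \<and> bit a (x - h) = b) \<and>
    (\<forall>r. r \<notin> {7, 10, 11, 12, 13, 14, 15} \<longrightarrow> R' r = R r))"
proof -
  have "(2 * x + of_bool b) div 2 = x" "(2 * x + of_bool b) mod 2 = of_bool b"
    by (cases b; simp)+
  moreover have "x < 2 ^ w" using assms(7) by linarith
  moreover note assms of_bool_less_word[OF assms(1)]
  ultimately show ?thesis
    unfolding literal_body_def
    by (simp add: drop_bit_mod_2_eq not_less less_imp_le)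
qed

text \<open>Links a specification \<open>Q'\<close> of the body to an induction hypothesis about the
  remaining iterations.\<close>

lemma terminates_While_step:
  assumes "R r \<noteq> 0" "terminates w P (R, M) Q'"
    and "\<And>t R' M'. Q' t (R', M') \<Longrightarrow> terminates w (While r P) (R', M') (\<lambda>t'. Q (1 + t + t'))"
  shows "terminates w (While r P) (R, M) Q"
proof -
  have "terminates w P (R, M) (\<lambda>t s. terminates w (While r P) s (\<lambda>t'. Q (1 + t + t')))"
    using assms(2) by (rule terminates_mono) (metis assms(3) surj_pair)
  then show ?thesis using assms(1) by (subst terminates_While) simp
qed

text \<open>Arbitrary initial flags \<open>p\<close> and \<open>q\<close> let the induction account
  for literals already read. Each literal costs 20 steps and one loop test.\<close>

lemma terminates_literal_loop:
  assumes "2 \<le> w" "length inp < 2 ^ w" "\<forall>y\<in>set inp. y < 2 ^ w" "a < 2 ^ w"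
    and "R 20 = 1" "R 17 = 2" "R 4 = h" "R 6 = a" "M 0 = array_of inp"
    and "drop (R 7) inp = map (\<lambda>(x, b). 2 * x + of_bool b) C @ rest"
    and "R 10 = length C" "R 11 = of_bool p" "R 12 = of_bool q"
  shows "terminates w (While 10 literal_body) (R, M) (\<lambda>t (R', M').
    t \<le> 1 + 21 * length C \<and> M' = M \<and> drop (R' 7) inp = rest \<and>
    R' 11 = of_bool (p \<or> sat_low h a C) \<and> R' 12 = of_bool (q \<or> sat_high h a C) \<and>
    (\<forall>r. r \<notin> {7, 10, 11, 12, 13, 14, 15} \<longrightarrow> R' r = R r))"
  using assms(5-)
proof (induction C arbitrary: R p q)
  case Nil
  then show ?case
    by (subst terminates_While) (simp add: sat_low_def sat_high_def)
next
  case (Cons l C)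
  obtain x b where l: "l = (x, b)" by fastforce
  note drop = array_of_drop[of "R 7" inp, OF Cons.prems(6)[unfolded l list.map append_Cons prod.case]]
  have "length (drop (R 7) inp) = Suc (length C + length rest)"
    unfolding Cons.prems(6) by simp
  then have len: "R 7 + Suc (length C) \<le> length inp" by simp
  have "M 0 (R 7) = 2 * x + of_bool b" "2 * x + of_bool b < 2 ^ w"
    "R 7 + 1 < 2 ^ w" "R 10 = Suc (length C)" "Suc (length C) < 2 ^ w"
    using drop(1,3) Cons.prems(5,7) len assms(2,3) by auto
  note body = terminates_literal_body[where R = R and M = M,
      OF assms(1) Cons.prems(1-4) this assms(4) Cons.prems(8,9)]
  show ?case
  proof (rule terminates_While_step[OF _ body], goal_cases)
    case (2 t R' M')
    then have M': "M' = M" by simp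
    have "terminates w (While 10 literal_body) (R', M) (\<lambda>t (R'', M'').
        t \<le> 1 + 21 * length C \<and> M'' = M \<and> drop (R'' 7) inp = rest \<and>
        R'' 11 = of_bool ((p \<or> x < h \<and> bit a x = b) \<or> sat_low h a C) \<and>
        R'' 12 = of_bool ((q \<or> h \<le> x \<and> bit a (x - h) = b) \<or> sat_high h a C) \<and>
        (\<forall>r. r \<notin> {7, 10, 11, 12, 13, 14, 15} \<longrightarrow> R'' r = R' r))"
      by (rule Cons.IH) (use 2 Cons.prems drop(2) in simp_all)
    then show ?case
      unfolding M' by (rule terminates_mono) (use 2 l in \<open>auto simp: sat_low_def sat_high_def\<close>)
  qed (use Cons.prems in simp_all)
qed

lemma terminates_emit:
  "terminates w (emit r) (R, M) Q \<longleftrightarrow>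
     R 16 + R 20 < 2 ^ w \<and> Q 3 (R(16 := R 16 + R 20), M(21 := (M 21)(R 16 := R r)))"
  by (simp add: emit_def numeral_3_eq_3)

text \<open>The last hypothesis fixes \<open>es\<close> as the edges of the clause \<open>C\<close>
  alone. There are at most three, hence the room for 6 output entries.\<close>

lemma terminates_clause_body:
  assumes "2 \<le> w" "length inp < 2 ^ w" "\<forall>y\<in>set inp. y < 2 ^ w" "a < 2 ^ w"
    and "R 20 = 1" "R 17 = 2" "R 4 = h" "R 6 = a" "R 18 = 2 ^ h + a" "R 8 = Suc j" "Suc j < 2 ^ w"
    and "R 9 = 2 * 2 ^ h + 2 * i" "2 * 2 ^ h + 2 * i + 2 < 2 ^ w"
    and "M 0 = array_of inp" "drop (R 7) inp = enc_clause C @ rest"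
    and "M 21 = array_of out" "R 16 = length out" "length out + 6 < 2 ^ w"
    and es: "clause_edges h a i (C # F) = es @ clause_edges h a (Suc i) F"
  shows "terminates w clause_body (R, M) (\<lambda>t (R', M').
    t \<le> 21 * length C + 40 \<and> M' = M(21 := array_of (out @ flatten es)) \<and>
    R' 16 = length (out @ flatten es) \<and>
    drop (R' 7) inp = rest \<and> R' 8 = j \<and> R' 9 = 2 * 2 ^ h + 2 * Suc i \<and>
    (\<forall>r. r \<notin> {7, 8, 9, 10, 11, 12, 13, 14, 15, 16} \<longrightarrow> R' r = R r))"
proof -
  note drop = array_of_drop[of "R 7" inp, OF assms(15)[unfolded enc_clause_def append_Cons]]
  have es: "es = [(a, 2 * 2 ^ h + 2 * i + of_bool (\<not> sat_low h a C)), (2 * 2 ^ h + 2 * i, 2 ^ h + a)] @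
     (if sat_high h a C then [(2 * 2 ^ h + 2 * i + 1, 2 ^ h + a)] else [])"
    using es by (auto split: if_splits)
  have "R 7 + 1 < 2 ^ w" "M 0 (R 7) = length C"
    using drop(1,4) assms(2,14) by auto
  \<comment> \<open>The updates describe the state after the five instructions that precede the
    loop.\<close>
  have "terminates w (While 10 literal_body)
      (R(10 := length C, 7 := Suc (R 7), 8 := j, 11 := 0, 12 := 0), M) (\<lambda>t (R', M').
      t \<le> 1 + 21 * length C \<and> M' = M \<and> drop (R' 7) inp = rest \<and>
      R' 11 = of_bool (False \<or> sat_low h a C) \<and> R' 12 = of_bool (False \<or> sat_high h a C) \<and>
      (\<forall>r. r \<notin> {7, 10, 11, 12, 13, 14, 15} \<longrightarrow>
         R' r = (R(10 := length C, 7 := Suc (R 7), 8 := j, 11 := 0, 12 := 0)) r))"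
    by (rule terminates_literal_loop) (use assms drop(2) in simp_all)
  note loop = terminates_mono[OF this]
  have "j < 2 ^ w" "2 * 2 ^ h + 2 * i + 1 < 2 ^ w" "2 * 2 ^ h + 2 * i < 2 ^ w"
    using assms(11,13) by simp_all
  note bounds = this \<open>R 7 + 1 < 2 ^ w\<close>
  have v: "2 * 2 ^ h + 2 * i + of_bool p < 2 ^ w" for p using bounds by (cases p) simp_all
  note len = \<open>M 0 (R 7) = length C\<close>[unfolded assms(14)]
  show ?thesis
    unfolding clause_body_def
    apply (simp add: assms bounds[simplified] terminates_emit len)
    apply (rule loop)
    apply clarify
    apply (simp add: assms terminates_emit es of_bool_less_word v)
    using assms(13,18) two_less_word[OF assms(1)] by auto
qed

text \<open>The edges of the added clause are split off from \<open>es\<close>, since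
  \<open>row_body\<close> emits them after this loop. The bound \<open>L\<close> on clause lengths
  makes the cost per clause uniform.\<close>

lemma terminates_clause_loop:
  assumes "2 \<le> w" "length inp < 2 ^ w" "\<forall>y\<in>set inp. y < 2 ^ w" "a < 2 ^ w"
    and "R 20 = 1" "R 17 = 2" "R 4 = h" "R 6 = a" "R 18 = 2 ^ h + a"
    and "R 8 = length F" "length F < 2 ^ w" "\<forall>C\<in>set F. length C \<le> L"
    and "R 9 = 2 * 2 ^ h + 2 * i" "2 * 2 ^ h + 2 * (i + length F) < 2 ^ w"
    and "M 0 = array_of inp" "drop (R 7) inp = concat (map enc_clause F)"
    and "M 21 = array_of out" "R 16 = length out" "length out + 6 * length F < 2 ^ w"
  shows "terminates w (While 8 clause_body) (R, M) (\<lambda>t (R', M').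
    \<exists>es. clause_edges h a i F = es @ clause_edges h a (i + length F) [] \<and>
      t \<le> 1 + length F * (21 * L + 41) \<and> M' = M(21 := array_of (out @ flatten es)) \<and>
      R' 16 = length (out @ flatten es) \<and> R' 9 = 2 * 2 ^ h + 2 * (i + length F) \<and>
      (\<forall>r. r \<notin> {7, 8, 9, 10, 11, 12, 13, 14, 15, 16} \<longrightarrow> R' r = R r))"
  using assms(5-)
proof (induction F arbitrary: R M i out)
  case Nil
  then show ?case by (subst terminates_While) (simp add: fun_upd_idem)
next
  case (Cons C F)
  define es where "es = [(a, 2 * 2 ^ h + 2 * i + of_bool (\<not> sat_low h a C)),
      (2 * 2 ^ h + 2 * i, 2 ^ h + a)] @
     (if sat_high h a C then [(2 * 2 ^ h + 2 * i + 1, 2 ^ h + a)] else [])"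
  have es: "clause_edges h a i (C # F) = es @ clause_edges h a (Suc i) F" "length es \<le> 3"
    by (simp_all add: es_def)
  have "R 8 = Suc (length F)" "Suc (length F) < 2 ^ w" "2 * 2 ^ h + 2 * i + 2 < 2 ^ w"
    "drop (R 7) inp = enc_clause C @ concat (map enc_clause F)" "length out + 6 < 2 ^ w"
    using Cons.prems by auto
  note body = terminates_clause_body[where R = R and M = M,
      OF assms(1-4) Cons.prems(1-5) this(1,2) Cons.prems(9) this(3) Cons.prems(11) this(4)
        Cons.prems(13,14) this(5) es(1)]
  show ?case
  proof (rule terminates_While_step[OF _ body], goal_cases)
    case (2 t R' M')
    have "terminates w (While 8 clause_body) (R', M') (\<lambda>t (R'', M'').
      \<exists>es'. clause_edges h a (Suc i) F = es' @ clause_edges h a (Suc i + length F) [] \<and>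
        t \<le> 1 + length F * (21 * L + 41) \<and>
        M'' = M'(21 := array_of ((out @ flatten es) @ flatten es')) \<and>
        R'' 16 = length ((out @ flatten es) @ flatten es') \<and>
        R'' 9 = 2 * 2 ^ h + 2 * (Suc i + length F) \<and>
        (\<forall>r. r \<notin> {7, 8, 9, 10, 11, 12, 13, 14, 15, 16} \<longrightarrow> R'' r = R' r))"
      by (rule Cons.IH) (use 2 Cons.prems es(2) in simp_all)
    then show ?case
    proof (rule terminates_mono, goal_cases)
      case (1 t' s')
      then obtain R'' es' where s': "s' = (R'', M'(21 := array_of ((out @ flatten es) @ flatten es')))"
        and *: "clause_edges h a (Suc i) F = es' @ clause_edges h a (Suc i + length F) []"
          "t' \<le> 1 + length F * (21 * L + 41)"
          "R'' 16 = length ((out @ flatten es) @ flatten es')"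
          "R'' 9 = 2 * 2 ^ h + 2 * (Suc i + length F)"
          "\<forall>r. r \<notin> {7, 8, 9, 10, 11, 12, 13, 14, 15, 16} \<longrightarrow> R'' r = R' r"
        by (cases s') blast
      have "length C \<le> L" using Cons.prems(8) by simp
      then have "1 + t + t' \<le> 1 + length (C # F) * (21 * L + 41)"
        using *(2) 2 by simp
      then show ?case
        unfolding s' prod.case by (intro exI[of _ "es @ es'"]) (use * 2 es(1) in simp)
    qed
  qed (use Cons.prems in simp_all)
qed

lemma terminates_row_body:
  assumes "2 \<le> w" "length inp < 2 ^ w" "\<forall>y\<in>set inp. y < 2 ^ w" "a < 2 ^ h"
    and "R 20 = 1" "R 17 = 2" "R 19 = 0" "R 3 = length F" "R 4 = h" "R 5 = 2 ^ h" "R 6 = Suc a"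
    and "length F < 2 ^ w" "\<forall>C\<in>set F. length C \<le> L" "2 * 2 ^ h + 2 * length F < 2 ^ w"
    and "M 0 = array_of inp" "drop 2 inp = concat (map enc_clause F)"
    and "M 21 = array_of out" "R 16 = length out" "length out + 6 * length F + 4 < 2 ^ w"
  shows "terminates w row_body (R, M) (\<lambda>t (R', M').
      t \<le> length F * (21 * L + 41) + 30 \<and>
      M' = M(21 := array_of (out @ flatten (clause_edges h a 0 F))) \<and>
      R' 16 = length (out @ flatten (clause_edges h a 0 F)) \<and> R' 6 = a \<and>
      (\<forall>r. r \<notin> {6, 7, 8, 9, 10, 11, 12, 13, 14, 15, 16, 18} \<longrightarrow> R' r = R r))"
proof -
  have bounds: "a < 2 ^ w" "2 ^ h + a < 2 ^ w" "2 ^ h + 2 ^ h < (2 :: nat) ^ w"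
    using assms(4,14) by linarith+
  have "terminates w (While 8 clause_body)
      (R(6 := a, 18 := 2 ^ h + a, 7 := 2, 9 := 2 ^ h + 2 ^ h, 8 := length F), M) (\<lambda>t (R', M').
    \<exists>es. clause_edges h a 0 F = es @ clause_edges h a (0 + length F) [] \<and>
      t \<le> 1 + length F * (21 * L + 41) \<and> M' = M(21 := array_of (out @ flatten es)) \<and>
      R' 16 = length (out @ flatten es) \<and> R' 9 = 2 * 2 ^ h + 2 * (0 + length F) \<and>
      (\<forall>r. r \<notin> {7, 8, 9, 10, 11, 12, 13, 14, 15, 16} \<longrightarrow>
        R' r = (R(6 := a, 18 := 2 ^ h + a, 7 := 2, 9 := 2 ^ h + 2 ^ h, 8 := length F)) r))"
    by (rule terminates_clause_loop) (use assms bounds in simp_all)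
  note loop = terminates_mono[OF this]
  show ?thesis
    unfolding row_body_def
    apply (simp add: assms terminates_emit bounds two_less_word)
    apply (rule loop)
    apply clarify
    apply (simp add: assms terminates_emit)
    using length_clause_edges[of h a 0 F] assms(19) by auto
qed

lemma terminates_row_loop:
  assumes "2 \<le> w" "length inp < 2 ^ w" "\<forall>y\<in>set inp. y < 2 ^ w" "k \<le> 2 ^ h"
    and "R 20 = 1" "R 17 = 2" "R 19 = 0" "R 3 = length F" "R 4 = h" "R 5 = 2 ^ h" "R 6 = k"
    and "length F < 2 ^ w" "\<forall>C\<in>set F. length C \<le> L" "2 * 2 ^ h + 2 * length F < 2 ^ w"
    and "M 0 = array_of inp" "drop 2 inp = concat (map enc_clause F)"
    and "M 21 = array_of out" "R 16 = length out" "length out + k * (6 * length F + 4) < 2 ^ w"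
  shows "terminates w (While 6 row_body) (R, M) (\<lambda>t (R', M').
      t \<le> 1 + k * (length F * (21 * L + 41) + 31) \<and>
      M' = M(21 := array_of (out @ flatten (edges_below h F k))) \<and>
      R' 16 = length (out @ flatten (edges_below h F k)) \<and>
      (\<forall>r. r \<notin> {6, 7, 8, 9, 10, 11, 12, 13, 14, 15, 16, 18} \<longrightarrow> R' r = R r))"
  using assms(4-)
proof (induction k arbitrary: R M out)
  case 0
  then show ?case by (subst terminates_While) (simp add: fun_upd_idem)
next
  case (Suc a)
  let ?es = "clause_edges h a 0 F"
  have "a < 2 ^ h" "length out + 6 * length F + 4 < 2 ^ w" using Suc.prems by simp_all
  note body = terminates_row_body[where R = R and M = M,
      OF assms(1-3) this(1) Suc.prems(2-15) this(2)]
  show ?case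
  proof (rule terminates_While_step[OF _ body], goal_cases)
    case (2 t R' M')
    have "terminates w (While 6 row_body) (R', M') (\<lambda>t (R'', M'').
      t \<le> 1 + a * (length F * (21 * L + 41) + 31) \<and>
      M'' = M'(21 := array_of ((out @ flatten ?es) @ flatten (edges_below h F a))) \<and>
      R'' 16 = length ((out @ flatten ?es) @ flatten (edges_below h F a)) \<and>
      (\<forall>r. r \<notin> {6, 7, 8, 9, 10, 11, 12, 13, 14, 15, 16, 18} \<longrightarrow> R'' r = R' r))"
      by (rule Suc.IH) (use 2 Suc.prems length_clause_edges[of h a 0 F] in simp_all)
    then show ?case
      by (rule terminates_mono) (use 2 in auto)
  qed (use Suc.prems in simp_all)
qed

lemma array_of_update [simp]: "i < length xs \<Longrightarrow> (array_of xs)(i := y) = array_of (xs[i := y])"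
  by (auto simp: array_of_def fun_eq_iff)

lemma enc_cnf_eq: "enc_cnf (n, F) = n # length F # concat (map enc_clause F)"
  by (simp add: enc_cnf_def enc_clause_def[abs_def])

lemma enc_digraph_eq: "enc_digraph (n, es) = n # length es # flatten es"
  by (simp add: enc_digraph_def flatten_def)

text \<open>Everything above index 21 is still 0, so from offset 21 on the state is an initial state
  for the solver. Registers 2 and 20 lie below the offset and keep their values for the final
  operation.\<close>

lemma terminates_build_graph:
  assumes "2 \<le> w" "length (enc_cnf (n, F)) < 2 ^ w" "\<forall>y\<in>set (enc_cnf (n, F)). y < 2 ^ w"
    and "n + 1 < 2 ^ w" "8 * 2 ^ half n * (length F + 1) < 2 ^ w" "\<forall>C\<in>set F. length C \<le> L"
  shows "terminates w build_graph (init_state (enc_cnf (n, F))) (\<lambda>t (R', M').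
      t \<le> 2 ^ half n * (length F * (21 * L + 41) + 31) + 30 \<and>
      M' 21 = array_of (enc_digraph (sat_graph (n, F))) \<and>
      R' 21 = length (enc_digraph (sat_graph (n, F))) \<and>
      (\<forall>A>21. M' A = (\<lambda>_. 0)) \<and> (\<forall>r>21. R' r = 0) \<and> R' 2 = length F + 1 \<and> R' 20 = 1)"
proof -
  let ?m = "length F" and ?h = "half n" and ?inp = "enc_cnf (n, F)"
  let ?N = "2 ^ ?h * Suc ?m * 4"
  let ?R = "(\<lambda>_. 0)(0 := length ?inp, 20 := Suc 0, 17 := 2, 3 := ?m, 4 := ?h,
    5 := 2 ^ ?h, 2 := Suc ?m, 14 := 4, 13 := ?N, 16 := 2, 6 := 2 ^ ?h)"
  let ?M = "(\<lambda>_ _. 0)(0 := array_of ?inp, 21 := array_of [?N, 0])"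
  have init: "init_state ?inp = ((\<lambda>_. 0)(0 := length ?inp), (\<lambda>_ _. 0)(0 := array_of ?inp))"
    by (simp add: init_state_def array_of_def[abs_def])
  have inp: "array_of ?inp 0 = n" "array_of ?inp (Suc 0) = ?m" "drop 2 ?inp = concat (map enc_clause F)"
    by (simp_all add: enc_cnf_eq array_of_def)
  \<comment> \<open>The second entry is the open place for the number of edges; edges are appended
    from position 2.\<close>
  have singleton: "(\<lambda>_. 0)(0 := ?N) = array_of [?N, 0]"
    by (auto simp: array_of_def fun_eq_iff less_Suc_eq)
  have half: "Suc n div 2 = ?h" by (simp add: half_def)
  have "1 * (?m + 1) \<le> 2 ^ ?h * (?m + 1)" "2 ^ ?h * 1 \<le> 2 ^ ?h * (?m + 1)"
    by (rule mult_right_mono mult_left_mono; simp)+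
  then have bounds: "?N < 2 ^ w" "2 * 2 ^ ?h + 2 * ?m < 2 ^ w"
    "2 + 2 ^ ?h * (6 * ?m + 4) < 2 ^ w" "Suc ?m < 2 ^ w"
    "(4 :: nat) < 2 ^ w" "2 ^ ?h * Suc ?m < 2 ^ w" "Suc n < 2 ^ w" "Suc 0 < 2 ^ w"
    and pow: "2 ^ ?h < (2 :: nat) ^ w"
    using assms(4,5) by (simp_all add: algebra_simps del: power_strict_increasing_iff)
  then have h: "?h < w" "?h < 2 ^ w" using pow order.strict_trans[OF less_exp pow] by auto
  have "terminates w (While 6 row_body) (?R, ?M) (\<lambda>t (R', M').
      t \<le> 1 + 2 ^ ?h * (?m * (21 * L + 41) + 31) \<and>
      M' = ?M(21 := array_of ([?N, 0] @ flatten (edges_below ?h F (2 ^ ?h)))) \<and>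
      R' 16 = length ([?N, 0] @ flatten (edges_below ?h F (2 ^ ?h))) \<and>
      (\<forall>r. r \<notin> {6, 7, 8, 9, 10, 11, 12, 13, 14, 15, 16, 18} \<longrightarrow> R' r = ?R r))"
    by (rule terminates_row_loop) (use assms bounds inp(3) in simp_all)
  note loop = terminates_mono[OF this]
  have "2 * length (edges_below ?h F (2 ^ ?h)) \<le> 2 ^ ?h * (6 * ?m + 4)"
    using length_edges_below[of ?h F "2 ^ ?h"] by (simp add: algebra_simps)
  then have len: "2 + 2 * length (edges_below ?h F (2 ^ ?h)) < 2 ^ w"
    using bounds(3) by linarith
  show ?thesis
    unfolding build_graph_def init
    apply (simp add: assms two_less_word half inp singleton bounds h del: mult_Suc mult_Suc_right)
    apply (rule loop)
    apply clarify
    apply (simp add: enc_digraph_eq sat_graph_def)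
    using len by (simp add: mult.commute mult.left_commute)
qed

section \<open>Running time\<close>

text \<open>Used twice: \<open>Minus\<close> with register 20 subtracts the added clause and gives
  \<open>max_sat\<close>; \<open>Equal\<close> with register 2 tests whether all clauses can be
  satisfied.\<close>

definition via_sat_graph :: "program \<Rightarrow> binop \<Rightarrow> reg \<Rightarrow> program" where
  "via_sat_graph P f r = block [build_graph, shift_program 21 P, Op f 0 21 r]"

section \<open>Satisfiability in terms of \<open>max_sat\<close>, and the combined program\<close>

lemma finite_sat_counts: "finite {length (filter (satisfies \<sigma>) F) |\<sigma>. True}"
  by (rule finite_subset[of _ "{..length F}"]) auto

lemma max_sat_in: "max_sat (n, F) \<in> {length (filter (satisfies \<sigma>) F) |\<sigma>. True}"
  unfolding max_sat_def prod.case by (rule Max_in[OF finite_sat_counts]) blast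

lemma max_sat_le: "max_sat (n, F) \<le> length F"
  using max_sat_in[of n F] by auto

lemma satisfiable_iff_max_sat: "satisfiable (n, F) \<longleftrightarrow> max_sat (n, F) = length F"
proof
  assume "satisfiable (n, F)"
  then obtain \<sigma> where "\<forall>C\<in>set F. satisfies \<sigma> C" by (auto simp: satisfiable_def)
  then have "length (filter (satisfies \<sigma>) F) = length F" by simp
  then have "length F \<le> max_sat (n, F)"
    unfolding max_sat_def prod.case by (intro Max_ge[OF finite_sat_counts]) (metis (mono_tags) mem_Collect_eq)
  then show "max_sat (n, F) = length F" using max_sat_le[of n F] by simp
next
  assume "max_sat (n, F) = length F"
  then obtain \<sigma> where "length (filter (satisfies \<sigma>) F) = length F" using max_sat_in[of n F] by auto
  then have "\<forall>C\<in>set F. satisfies \<sigma> C"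
    by (metis length_filter_less less_irrefl)
  then show "satisfiable (n, F)" by (auto simp: satisfiable_def)
qed

text \<open>A clause repeats no literal. The bound serves as \<open>L\<close> for the builder and
  turns \<open>21 * L\<close> into \<open>42 * n\<close>.\<close>

lemma length_clause_le:
  assumes "is_cnf (n, F)" "C \<in> set F"
  shows "length C \<le> 2 * n"
proof -
  have "set C \<subseteq> {..<n} \<times> UNIV" using assms by (auto simp: is_cnf_def)
  then have "card (set C) \<le> card ({..<n} \<times> (UNIV :: bool set))" by (intro card_mono) auto
  then show ?thesis using assms by (simp add: is_cnf_def distinct_card card_cartesian_product)
qed

lemma computes_via_sat_graph:
  assumes cnf: "is_cnf (n, F)"
    and P: "computes w0 P (enc_digraph (sat_graph (n, F))) t0 (max_sat (n, F) + 1)"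
    and w: "w0 \<le> w" "2 \<le> w" "length (enc_cnf (n, F)) < 2 ^ w" "\<forall>y\<in>set (enc_cnf (n, F)). y < 2 ^ w"
      "n + 1 < 2 ^ w" "8 * 2 ^ half n * (length F + 1) < 2 ^ w"
    and r: "r = 2 \<and> y = length F + 1 \<or> r = 20 \<and> y = 1" "eval_binop f (max_sat (n, F) + 1) y < 2 ^ w"
  shows "\<exists>t. computes w (via_sat_graph P f r) (enc_cnf (n, F)) t (eval_binop f (max_sat (n, F) + 1) y) \<and>
    t \<le> 2 ^ half n * (length F * (42 * n + 41) + 31) + t0 + 32"
proof -
  let ?inp = "enc_cnf (n, F)" and ?out = "enc_digraph (sat_graph (n, F))"
  have "\<forall>C\<in>set F. length C \<le> 2 * n" using length_clause_le[OF cnf] by blast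
  from terminates_build_graph[OF w(2-6) this] obtain t R M where
    build: "exec w build_graph (init_state ?inp) t (R, M)"
    and t: "t \<le> 2 ^ half n * (length F * (42 * n + 41) + 31) + 30"
    and out: "M 21 = array_of ?out" "R 21 = length ?out" "\<forall>A>21. M A = (\<lambda>_. 0)" "\<forall>r>21. R r = 0"
    and regs: "R 2 = length F + 1" "R 20 = 1"
    unfolding terminates_def by auto
  obtain R' M' where "exec w0 P (init_state ?out) t0 (R', M')" and R': "R' 0 = max_sat (n, F) + 1"
    using P by (auto simp: computes_def)
  note shifted = exec_shift_program[OF exec_mono_word[OF this(1) w(1), unfolded init_state_def], of 21 R M]
  \<comment> \<open>The state left by the builder is the shifted initial state of the solver, so the
    two runs can be joined.\<close>
  have "overlay 21 R ((\<lambda>_. 0)(0 := length ?out)) = R"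
    using out(2,4) by (auto simp: overlay_def fun_eq_iff)
  moreover have "overlay 21 M ((\<lambda>_ _. 0)(0 := \<lambda>i. if i < length ?out then ?out ! i else 0)) = M"
    using out(1,3) by (auto simp: overlay_def fun_eq_iff array_of_def)
  ultimately have "exec w (shift_program 21 P) (R, M) t0 (overlay 21 R R', overlay 21 M M')"
    using shifted by simp
  moreover have "overlay 21 R R' 21 = max_sat (n, F) + 1" "overlay 21 R R' r = y"
    using R' regs r(1) by (auto simp: overlay_def)
  then have "exec w (Seq (Op f 0 21 r) Skip) (overlay 21 R R', overlay 21 M M') (1 + 1)
      ((overlay 21 R R')(0 := eval_binop f (max_sat (n, F) + 1) y), overlay 21 M M')"
    using r(2) by (simp add: exec_Seq_iff exec_Op_iff exec_Skip_iff)
  ultimately have "exec w (via_sat_graph P f r) (init_state ?inp) (t + (t0 + (1 + 1)))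
      ((overlay 21 R R')(0 := eval_binop f (max_sat (n, F) + 1) y), overlay 21 M M')"
    unfolding via_sat_graph_def block.simps using build by (blast intro: exec.Seq)
  then have "computes w (via_sat_graph P f r) ?inp (t + (t0 + (1 + 1))) (eval_binop f (max_sat (n, F) + 1) y)"
    unfolding computes_def using w(3,4) by fastforce
  then show ?thesis using t by (intro exI[of _ "t + (t0 + (1 + 1))"]) simp
qed

section \<open>Growth estimates\<close>

lemma bigo_powr_bound:
  fixes T :: "nat \<Rightarrow> real"
  assumes "T \<in> O(\<lambda>n. real n powr (2 - \<epsilon>))" "e \<le> \<epsilon>" "e \<le> 2"
  obtains C where "C \<ge> 0" "\<And>n. n \<ge> 1 \<Longrightarrow> T n \<le> C * real n powr (2 - e)"
proof -
  obtain c where "c > 0" "\<forall>\<^sub>F n in at_top. norm (T n) \<le> c * norm (real n powr (2 - \<epsilon>))"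
    using assms(1) by (rule landau_o.bigE)
  then obtain N where c: "c > 0" "\<And>n. n \<ge> N \<Longrightarrow> norm (T n) \<le> c * norm (real n powr (2 - \<epsilon>))"
    unfolding eventually_at_top_linorder by blast
  \<comment> \<open>The sum covers the finitely many arguments below \<open>N\<close>; it suffices
    there because the power is at least 1.\<close>
  let ?C = "c + (\<Sum>i<N. \<bar>T i\<bar>)"
  show thesis
  proof (rule that[of ?C])
    show "0 \<le> ?C" using c(1) by (simp add: sum_nonneg)
    fix n :: nat assume n: "n \<ge> 1"
    have ge1: "1 \<le> real n powr (2 - e)" using n assms(3) by (simp add: ge_one_powr_ge_zero)
    show "T n \<le> ?C * real n powr (2 - e)"
    proof (cases "n < N")
      case True
      then have "\<bar>T n\<bar> \<le> (\<Sum>i<N. \<bar>T i\<bar>)" by (intro member_le_sum) auto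
      then have "T n \<le> ?C * 1" using c(1) by simp
      also have "\<dots> \<le> ?C * real n powr (2 - e)"
        using ge1 \<open>0 \<le> ?C\<close> by (intro mult_left_mono)
      finally show ?thesis .
    next
      case False
      then have "T n \<le> c * real n powr (2 - \<epsilon>)" using c(2)[of n] by simp
      also have "\<dots> \<le> ?C * real n powr (2 - e)"
        using n assms(2) c(1) by (intro mult_mono powr_mono) (auto intro: sum_nonneg)
      finally show ?thesis .
    qed
  qed
qed

lemma half_powr_bound: "2 ^ half n \<le> 2 * 2 powr (real n / 2)"
proof -
  have "real (half n) \<le> real n / 2 + 1" by (simp add: half_def)
  then have "2 powr real (half n) \<le> 2 powr (real n / 2 + 1)" by simp
  then show ?thesis by (simp add: powr_realpow powr_add)
qed

text \<open>Follows from \<open>1 + x \<le> exp x\<close> and \<open>ln 2 \<ge> 1 / 2\<close>. It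
  absorbs the factor linear in \<open>n\<close>, as the time bound in \<open>SETH\<close> allows a
  polynomial in the number of clauses only.\<close>

lemma Suc_le_powr_quarter: "real n + 1 \<le> 8 * 2 powr (real n / 4)"
proof -
  have "1 / 2 \<le> ln (2 :: real)" by (subst ln_ge_iff) (use exp_half_le2 in auto)
  then have "real n / 4 * (1 / 2) \<le> real n / 4 * ln 2" by (intro mult_left_mono) auto
  moreover have "1 + real n / 4 * ln 2 \<le> exp (real n / 4 * ln 2)" by (rule exp_ge_add_one_self)
  ultimately have "1 + real n / 8 \<le> exp (real n / 4 * ln 2)" by linarith
  then show ?thesis by (simp add: powr_def)
qed

text \<open>The solver alone would permit \<open>1 - e / 2\<close>; the builder needs exponent
  \<open>3 / 4\<close> once the linear factor is absorbed. For \<open>e \<le> 1\<close> the value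
  \<open>1 - e / 4\<close> covers both. \<open>m\<close> is real so that bounds on the number of
  clauses can be inserted.\<close>

definition time_bound :: "real \<Rightarrow> real \<Rightarrow> nat \<Rightarrow> real \<Rightarrow> real" where
  "time_bound C e n m = C * 2 powr ((1 - e / 4) * real n) * (1 + m)\<^sup>2"

lemma build_time_bound:
  assumes "0 < e" "e \<le> 1"
  shows "82 * 2 ^ half n * (real m + 1) * (real n + 1) \<le> time_bound 1312 e n m"
proof -
  have "82 * 2 ^ half n * (real m + 1) * (real n + 1) \<le>
      82 * (2 * 2 powr (real n / 2)) * (real m + 1)\<^sup>2 * (8 * 2 powr (real n / 4))"
  proof (intro mult_mono)
    show "real m + 1 \<le> (real m + 1)\<^sup>2" by (simp add: power2_eq_square algebra_simps)
  qed (use half_powr_bound[of n] Suc_le_powr_quarter[of n] in auto)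
  also have "\<dots> = 1312 * 2 powr (real n / 2 + real n / 4) * (1 + real m)\<^sup>2"
    unfolding powr_add by (simp add: ac_simps)
  also have "\<dots> \<le> time_bound 1312 e n m"
  proof -
    have "(e / 4) * real n \<le> (1 / 4) * real n" using assms by (intro mult_right_mono) auto
    then have "real n / 2 + real n / 4 \<le> (1 - e / 4) * real n" by (simp add: algebra_simps)
    then show ?thesis unfolding time_bound_def by (intro mult_right_mono mult_left_mono) auto
  qed
  finally show ?thesis .
qed

lemma solver_time_bound:
  assumes "0 < e" "e \<le> 1"
  shows "real (4 * 2 ^ half n * (m + 1)) powr (2 - e) \<le> time_bound 64 e n m"
proof -
  have "real (4 * 2 ^ half n * (m + 1)) \<le> 8 * (real m + 1) * 2 powr (real n / 2)"
    using mult_right_mono[OF half_powr_bound[of n], of "4 * (real m + 1)"] by (simp add: algebra_simps)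
  then have "real (4 * 2 ^ half n * (m + 1)) powr (2 - e) \<le>
      (8 * (real m + 1) * 2 powr (real n / 2)) powr (2 - e)"
    using assms by (intro powr_mono2) auto
  also have "\<dots> = (8 * (real m + 1)) powr (2 - e) * 2 powr (real n / 2 * (2 - e))"
    by (simp add: powr_mult powr_powr)
  also have "\<dots> \<le> (8 * (real m + 1)) powr 2 * 2 powr ((1 - e / 4) * real n)"
  proof (rule mult_mono)
    have "0 \<le> e * real n / 4" using assms by simp
    then show "2 powr (real n / 2 * (2 - e)) \<le> 2 powr ((1 - e / 4) * real n)"
      by (intro powr_mono) (simp_all add: field_simps)
    show "(8 * (real m + 1)) powr (2 - e) \<le> (8 * (real m + 1)) powr 2"
      using assms by (intro powr_mono) auto
  qed auto
  also have "(8 * (real m + 1)) powr 2 = 64 * (1 + real m)\<^sup>2"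
    by (simp add: power2_eq_square algebra_simps)
  finally show ?thesis by (simp add: time_bound_def mult.commute mult.left_commute)
qed

section \<open>Encoding size and word length\<close>

lemma sum_list_flatten: "sum_list (flatten es) = (\<Sum>(u, v)\<leftarrow>es. u + v)"
  by (induction es) auto

text \<open>The word length of the solver depends on this sum; being polynomial in \<open>N\<close>,
  it changes the logarithm by a constant factor only.\<close>

lemma enc_sat_graph_size:
  fixes n F
  defines "N \<equiv> 4 * 2 ^ half n * (length F + 1)"
  shows "length (enc_digraph (sat_graph (n, F))) + sum_list (enc_digraph (sat_graph (n, F))) \<le>
    2 + 4 * N + 2 * N * N"
proof -
  let ?es = "snd (sat_graph (n, F))"
  have len: "length ?es \<le> N" using length_sat_graph[of n F] by (simp add: sat_graph_def N_def)
  have graph: "sat_graph (n, F) = (N, ?es)" by (simp add: sat_graph_def N_def)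
  then interpret digraph "digraph_of (N, ?es)"
    using is_digraph_sat_graph[of n F] by (metis (no_types, lifting) case_prodD is_digraph_def)
  have "u + v \<le> 2 * N" if "(u, v) \<in> set ?es" for u v
    using tail_in_verts[of "(u, v)"] head_in_verts[of "(u, v)"] that by (simp add: digraph_of_def)
  then have "(\<Sum>(u, v)\<leftarrow>?es. u + v) \<le> (\<Sum>_\<leftarrow>?es. 2 * N)"
    by (intro sum_list_mono) auto
  also have "\<dots> \<le> 2 * N * N" using len by (simp add: sum_list_triv)
  finally show ?thesis
    using len by (subst (1 2) graph) (simp add: enc_digraph_eq sum_list_flatten)
qed

lemma via_sat_graph_solves:
  assumes "0 < e" "e \<le> 1" "e \<le> \<epsilon>"
    and T: "T \<in> O(\<lambda>n. real n powr (2 - \<epsilon>))"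
    and P: "solves P (\<lambda>(n, es). is_digraph (n, es) \<and> real (length es) \<le> real n)
      enc_digraph (\<lambda>G. max_local_edge_connectivity (digraph_of G)) (\<lambda>(n, es). T n)"
  obtains C where "C > 0"
    "\<And>f r y. (\<And>m. r = 2 \<and> y m = m + 1 \<or> r = 20 \<and> y m = 1) \<Longrightarrow>
       (\<And>k m. k \<le> m \<Longrightarrow> eval_binop f (k + 1) (y m) \<le> m + 1) \<Longrightarrow>
       solves (via_sat_graph P f r) is_cnf enc_cnf
         (\<lambda>(n, F). eval_binop f (max_sat (n, F) + 1) (y (length F)))
         (\<lambda>(n, F). time_bound C e n (length F))"
proof -
  obtain C0 where C0: "C0 \<ge> 0" "\<And>n. n \<ge> 1 \<Longrightarrow> T n \<le> C0 * real n powr (2 - e)"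
    using bigo_powr_bound[OF T assms(3)] assms(2) by auto
  obtain c where *: "\<forall>x. (case x of (n, es) \<Rightarrow> is_digraph (n, es) \<and> real (length es) \<le> real n) \<longrightarrow>
      (\<exists>w t. computes w P (enc_digraph x) t (max_local_edge_connectivity (digraph_of x)) \<and>
        real t \<le> (case x of (n, es) \<Rightarrow> T n) \<and> real w \<le> c * log 2 (2 + real (length (enc_digraph x)) +
          real (sum_list (enc_digraph x)) + (case x of (n, es) \<Rightarrow> T n)))"
    using P unfolding solves_def by (rule exE)
  have c: "\<And>n es. is_digraph (n, es) \<Longrightarrow> length es \<le> n \<Longrightarrow>
      \<exists>w t. computes w P (enc_digraph (n, es)) t (max_local_edge_connectivity (digraph_of (n, es))) \<and>
        real t \<le> T n \<and> real w \<le> c * log 2 (2 + real (length (enc_digraph (n, es))) +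
          real (sum_list (enc_digraph (n, es))) + T n)"
    using *[rule_format, of "(n, es)" for n es] by simp
  define C where "C = 1312 + 64 * C0"
  show thesis
  proof (rule that[of C])
    show "0 < C" using C0(1) by (simp add: C_def)
    fix f and r :: reg and y :: "nat \<Rightarrow> nat"
    assume y: "\<And>m. r = 2 \<and> y m = m + 1 \<or> r = 20 \<and> y m = 1"
      and f: "\<And>k m. k \<le> m \<Longrightarrow> eval_binop f (k + 1) (y m) \<le> m + 1"
    have "\<exists>w t. computes w (via_sat_graph P f r) (enc_cnf (n, F)) t
          (eval_binop f (max_sat (n, F) + 1) (y (length F))) \<and>
        real t \<le> time_bound C e n (length F) \<and>
        real w \<le> (5 * \<bar>c\<bar> + 7) * log 2 (2 + real (length (enc_cnf (n, F))) +
          real (sum_list (enc_cnf (n, F))) + time_bound C e n (length F))"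
      if cnf: "is_cnf (n, F)" for n F
    proof -
      let ?m = "length F" and ?inp = "enc_cnf (n, F)"
      define N where "N = 4 * 2 ^ half n * (?m + 1)"
      \<comment> \<open>The factor 82 exceeds the 42 needed for the builder by enough to absorb the
        remaining 32 steps, as \<open>B \<ge> 82\<close>.\<close>
      define B where "B = 82 * 2 ^ half n * (real ?m + 1) * (real n + 1)"
      define X where "X = 2 + real (length ?inp) + real (sum_list ?inp) + time_bound C e n ?m"
      obtain es where G: "sat_graph (n, F) = (N, es)" by (simp add: sat_graph_def N_def)
      have "is_digraph (N, es)" "length es \<le> N"
        using is_digraph_sat_graph[of n F] length_sat_graph[of n F] by (simp_all add: G)
      moreover have "max_local_edge_connectivity (digraph_of (N, es)) = max_sat (n, F) + 1"
        using max_local_edge_connectivity_sat_graph[OF cnf] by (simp only: G)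
      ultimately obtain w0 t0 where
        w0: "computes w0 P (enc_digraph (sat_graph (n, F))) t0 (max_sat (n, F) + 1)" "real t0 \<le> T N"
          "real w0 \<le> c * log 2 (2 + real (length (enc_digraph (sat_graph (n, F)))) +
            real (sum_list (enc_digraph (sat_graph (n, F)))) + T N)"
        unfolding G using c[of N es] by metis
      have "T N \<le> C0 * real N powr (2 - e)" by (rule C0(2)) (simp add: N_def Suc_le_eq)
      also have "\<dots> \<le> C0 * time_bound 64 e n ?m"
        unfolding N_def by (intro mult_left_mono solver_time_bound assms C0)
      finally have T: "B + T N \<le> time_bound C e n ?m"
        using build_time_bound[OF assms(1,2), of n ?m]
        by (simp add: B_def C_def time_bound_def algebra_simps)
      define Z where "Z = 2 ^ half n * (real ?m + 1)"
      have "1 * 1 \<le> Z" unfolding Z_def by (intro mult_mono) auto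
      then have "1 * 1 \<le> Z * (real n + 1)" "Z * 1 \<le> Z * (real n + 1)"
        by (intro mult_mono; simp)+
      moreover have B_eq: "B = 82 * (Z * (real n + 1))" by (simp add: B_def Z_def)
      moreover have "real N = 4 * Z" by (simp add: N_def Z_def algebra_simps)
      ultimately have B_ge: "82 \<le> B" and N: "real N \<le> B / 2" by linarith+
      have "?m * (42 * n + 41) + 31 \<le> 42 * ((?m + 1) * (n + 1))" by (simp add: algebra_simps)
      then have "2 ^ half n * (?m * (42 * n + 41) + 31) \<le> 2 ^ half n * (42 * ((?m + 1) * (n + 1)))"
        by (intro mult_left_mono) auto
      then have "real (2 ^ half n * (?m * (42 * n + 41) + 31)) \<le> real (2 ^ half n * (42 * ((?m + 1) * (n + 1))))"
        by (rule of_nat_mono)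
      also have "\<dots> = 42 / 82 * B" unfolding B_def of_nat_mult of_nat_power of_nat_add by simp
      finally have B: "real (2 ^ half n * (?m * (42 * n + 41) + 31) + 32) \<le> B"
        using B_ge by simp
      have "0 \<le> T N" using w0(2) by (rule order.trans[rotated]) simp
      then have X: "2 \<le> X" "real N \<le> X" "T N \<le> X"
        using T N B_ge unfolding X_def by simp_all
      \<comment> \<open>The added \<open>k\<close> bits give \<open>32 * X \<le> 2 ^ k\<close>,
        enough for every value outside the solver; \<open>w0 + k\<close> also exceeds the word
        length of the solver.\<close>
      define k where "k = nat \<lceil>log 2 X\<rceil> + 5"
      have logX: "1 \<le> log 2 X" using X(1) by simp
      have "X = 2 powr (log 2 X)" using X(1) by simp
      also have "\<dots> \<le> 2 powr (real (nat \<lceil>log 2 X\<rceil>))" by (intro powr_mono) (auto intro: real_nat_ceiling_ge)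
      finally have k: "32 * X \<le> 2 ^ k" by (simp add: k_def powr_realpow power_add)
      have "32 * X \<le> 2 ^ (w0 + k)"
        by (rule order.trans[OF k power_increasing]) auto
      then have small: "x < 2 ^ (w0 + k)" if "real x \<le> 2 * X" for x :: nat
      proof -
        have "real x < 2 ^ (w0 + k)" using that X(1) \<open>32 * X \<le> 2 ^ (w0 + k)\<close> by linarith
        then show ?thesis by simp
      qed
      have le_sum: "z \<le> sum_list ?inp" if "z \<in> set ?inp" for z
        using that by (intro member_le_sum_list) auto
      have "0 \<le> time_bound C e n ?m" using T B_ge \<open>0 \<le> T N\<close> by linarith
      then have inp: "real (length ?inp) \<le> X" "real (sum_list ?inp) + 2 \<le> X"
        unfolding X_def by simp_all
      have max_le: "eval_binop f (max_sat (n, F) + 1) (y ?m) \<le> N"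
      proof -
        have "1 * (?m + 1) \<le> N" unfolding N_def by (rule mult_right_mono) auto
        then show ?thesis using f[OF max_sat_le[of n F]] by simp
      qed
      have word: "length ?inp < 2 ^ (w0 + k)" "\<forall>z\<in>set ?inp. z < 2 ^ (w0 + k)" "n + 1 < 2 ^ (w0 + k)"
        "8 * 2 ^ half n * (?m + 1) < 2 ^ (w0 + k)"
        "eval_binop f (max_sat (n, F) + 1) (y ?m) < 2 ^ (w0 + k)"
      proof -
        show "length ?inp < 2 ^ (w0 + k)" using inp X by (intro small) simp
        show "\<forall>z\<in>set ?inp. z < 2 ^ (w0 + k)"
        proof
          fix z assume "z \<in> set ?inp"
          then have "real z \<le> real (sum_list ?inp)" using le_sum by simp
          then show "z < 2 ^ (w0 + k)" using inp X by (intro small) simp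
        qed
        have "real n \<le> real (sum_list ?inp)" using le_sum[of n] by (simp add: enc_cnf_eq)
        then show "n + 1 < 2 ^ (w0 + k)" using inp X by (intro small) simp
        show "8 * 2 ^ half n * (?m + 1) < 2 ^ (w0 + k)" using X(2) by (intro small) (simp add: N_def)
        have "real (eval_binop f (max_sat (n, F) + 1) (y ?m)) \<le> real N"
          using max_le by (rule of_nat_mono)
        then show "eval_binop f (max_sat (n, F) + 1) (y ?m) < 2 ^ (w0 + k)"
          using X(1,2) by (intro small) linarith
      qed
      have "w0 \<le> w0 + k" "2 \<le> w0 + k" by (simp_all add: k_def)
      from computes_via_sat_graph[OF cnf w0(1) this word(1-4) y word(5)] obtain t where
        t: "computes (w0 + k) (via_sat_graph P f r) ?inp t (eval_binop f (max_sat (n, F) + 1) (y ?m))"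
          "t \<le> 2 ^ half n * (?m * (42 * n + 41) + 31) + t0 + 32" by blast
      have "real t \<le> real (2 ^ half n * (?m * (42 * n + 41) + 31) + 32) + real t0"
        using t(2) by (simp flip: of_nat_add)
      then have time: "real t \<le> time_bound C e n ?m" using B w0(2) T by linarith
      have "real w0 \<le> 5 * \<bar>c\<bar> * log 2 X"
      proof -
        let ?S = "2 + real (length (enc_digraph (sat_graph (n, F)))) +
          real (sum_list (enc_digraph (sat_graph (n, F)))) + T N"
        have "real (length (enc_digraph (sat_graph (n, F))) + sum_list (enc_digraph (sat_graph (n, F)))) \<le>
            real (2 + 4 * N + 2 * N * N)"
          using enc_sat_graph_size[of n F] unfolding N_def by (rule of_nat_mono)
        also have "\<dots> = 2 + 4 * real N + 2 * (real N * real N)"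
          by (simp only: of_nat_add of_nat_mult of_nat_numeral mult.assoc)
        also have "\<dots> \<le> 2 + 4 * X + 2 * (X * X)"
          using X by (intro add_mono mult_mono) auto
        finally have "?S \<le> 4 + 5 * X + 2 * (X * X)" using X(3) by simp
        also have "\<dots> \<le> 8 * (X * X)"
        proof -
          have "2 * 2 \<le> X * X" "2 * X \<le> X * X" using X(1) by (intro mult_mono; simp)+
          then show ?thesis by linarith
        qed
        also have "\<dots> \<le> X ^ 3 * (X * X)"
        proof (rule mult_right_mono)
          show "8 \<le> X ^ 3" using power_mono[of 2 X 3] X(1) by simp
        qed (use X(1) in simp)
        finally have S: "?S \<le> X ^ 5" by (simp add: eval_nat_numeral ac_simps)
        have "2 \<le> ?S" using \<open>0 \<le> T N\<close> by simp
        then have "0 \<le> log 2 ?S" "log 2 ?S \<le> log 2 (X ^ 5)"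
          using S by (simp, subst log_le_cancel_iff) (use X(1) in auto)
        moreover have "log 2 (X ^ 5) = 5 * log 2 X" using X(1) by (simp add: log_nat_power)
        ultimately have "c * log 2 ?S \<le> \<bar>c\<bar> * (5 * log 2 X)"
          by (intro mult_mono) auto
        then show ?thesis using w0(3) by simp
      qed
      \<comment> \<open>Rounding up adds at most 1 and the definition of \<open>k\<close> adds 5;
        both are absorbed because \<open>log 2 X \<ge> 1\<close>.\<close>
      moreover have "real k \<le> 7 * log 2 X"
        using logX by (simp add: k_def) linarith
      ultimately have "real (w0 + k) \<le> (5 * \<bar>c\<bar> + 7) * log 2 X"
        by (simp add: distrib_right)
      then show ?thesis using t(1) time unfolding X_def by blast
    qed
    then show "solves (via_sat_graph P f r) is_cnf enc_cnf
         (\<lambda>(n, F). eval_binop f (max_sat (n, F) + 1) (y (length F)))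
         (\<lambda>(n, F). time_bound C e n (length F))"
      unfolding solves_def by (intro exI[of _ "5 * \<bar>c\<bar> + 7"]) (simp add: split_paired_all)
  qed
qed

lemma solves_mono:
  assumes "solves P I enc ans T"
    and "\<And>x. I' x \<Longrightarrow> I x" "\<And>x. I' x \<Longrightarrow> T x \<le> T' x" "\<And>x. I' x \<Longrightarrow> ans' x = ans x"
  shows "solves P I' enc ans' T'"
proof -
  obtain c where c: "\<And>x. I x \<Longrightarrow> \<exists>w t. computes w P (enc x) t (ans x) \<and> real t \<le> T x \<and>
      real w \<le> c * log 2 (2 + real (length (enc x)) + real (sum_list (enc x)) + T x)"
    using assms(1) unfolding solves_def by blast
  show ?thesis
    unfolding solves_def
  \<comment> \<open>For negative \<open>c\<close> a larger time bound would shrink the allowed word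
    length, hence the absolute value.\<close>
  proof (intro exI[of _ "\<bar>c\<bar>"] allI impI)
    fix x assume x: "I' x"
    let ?S = "\<lambda>T. 2 + real (length (enc x)) + real (sum_list (enc x)) + T x"
    from c[OF assms(2)[OF x]] obtain w t where wt: "computes w P (enc x) t (ans x)" "real t \<le> T x"
      "real w \<le> c * log 2 (?S T)" by blast
    have "0 \<le> T x" using wt(2) by (rule order.trans[rotated]) simp
    then have log: "0 \<le> log 2 (?S T)" "log 2 (?S T) \<le> log 2 (?S T')"
      using assms(3)[OF x] by simp_all
    have "c * log 2 (?S T) \<le> \<bar>c\<bar> * log 2 (?S T')"
      using log by (intro mult_mono) auto
    then show "\<exists>w t. computes w P (enc x) t (ans' x) \<and> real t \<le> T' x \<and>
        real w \<le> \<bar>c\<bar> * log 2 (?S T')"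
      using wt assms(3,4)[OF x] by (intro exI[of _ w] exI[of _ t]) auto
  qed
qed

theorem theorem1p5:
  fixes \<epsilon> :: real
  assumes "\<epsilon> > 0"
    and "\<forall>f \<in> soft_O (\<lambda>n. real n). \<exists>P T.
           T \<in> O(\<lambda>n. real n powr (2 - \<epsilon>)) \<and>
           solves P (\<lambda>(n, es). is_digraph (n, es) \<and> real (length es) \<le> f n)
             enc_digraph (\<lambda>G. max_local_edge_connectivity (digraph_of G)) (\<lambda>(n, es). T n)"
  shows "(\<exists>\<delta>>0. \<forall>g \<in> O(\<lambda>n. real n). \<exists>P T.
           T \<in> O(\<lambda>n. 2 powr ((1 - \<delta>) * real n)) \<and>
           solves P (\<lambda>(n, F). is_cnf (n, F) \<and> real (length F) \<le> g n)
             enc_cnf max_sat (\<lambda>(n, F). T n))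
         \<and> \<not> SETH"
proof -
  define e where "e = min \<epsilon> 1"
  have e: "0 < e" "e \<le> 1" "e \<le> \<epsilon>" using assms(1) by (auto simp: e_def)
  \<comment> \<open>Exponent 0 of the logarithm suffices, because the padded graph has no more edges
    than vertices.\<close>
  have "(\<lambda>n. real n) \<in> soft_O (\<lambda>n. real n)"
    unfolding soft_O_def by (auto intro!: exI[of _ 0])
  with assms(2) obtain P T where PT: "T \<in> O(\<lambda>n. real n powr (2 - \<epsilon>))"
    "solves P (\<lambda>(n, es). is_digraph (n, es) \<and> real (length es) \<le> real n)
      enc_digraph (\<lambda>G. max_local_edge_connectivity (digraph_of G)) (\<lambda>(n, es). T n)" by blast
  obtain C where C: "C > 0" and solver:
    "\<And>f r y. (\<And>m. r = 2 \<and> y m = m + 1 \<or> r = 20 \<and> y m = 1) \<Longrightarrow>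
       (\<And>k m. k \<le> m \<Longrightarrow> eval_binop f (k + 1) (y m) \<le> m + 1) \<Longrightarrow>
       solves (via_sat_graph P f r) is_cnf enc_cnf
         (\<lambda>(n, F). eval_binop f (max_sat (n, F) + 1) (y (length F)))
         (\<lambda>(n, F). time_bound C e n (length F))"
    using via_sat_graph_solves[OF e PT] by blast
  \<comment> \<open>Half of the saving \<open>e / 4\<close> pays for the quadratic factor in the
    number of clauses, which leaves \<open>e / 8\<close>.\<close>
  have max_sat: "\<exists>P T. T \<in> O(\<lambda>n. 2 powr ((1 - e / 8) * real n)) \<and>
      solves P (\<lambda>(n, F). is_cnf (n, F) \<and> real (length F) \<le> g n) enc_cnf max_sat (\<lambda>(n, F). T n)"
    if g: "g \<in> O(\<lambda>n. real n)" for g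
  proof (intro exI conjI)
    show "solves (via_sat_graph P Minus 20) (\<lambda>(n, F). is_cnf (n, F) \<and> real (length F) \<le> g n)
        enc_cnf max_sat (\<lambda>(n, F). time_bound C e n \<bar>g n\<bar>)"
      by (rule solves_mono[OF solver[of 20 "\<lambda>_. 1" Minus]])
         (use C in \<open>auto simp: time_bound_def intro!: mult_left_mono power_mono mult_nonneg_nonneg\<close>)
    obtain K where K: "K > 0" "\<forall>\<^sub>F n in at_top. norm (g n) \<le> K * norm (real n)"
      using g by (rule landau_o.bigE)
    have "(\<lambda>n. time_bound C e n \<bar>g n\<bar>) \<in> O(\<lambda>n. time_bound C e n (K * real n))"
    proof (rule landau_o.big_mono)
      show "\<forall>\<^sub>F n in at_top. norm (time_bound C e n \<bar>g n\<bar>) \<le> norm (time_bound C e n (K * real n))"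
        using K(2) by eventually_elim (use C in \<open>auto simp: time_bound_def intro!: mult_left_mono power_mono\<close>)
    qed
    also have "(\<lambda>n. time_bound C e n (K * real n)) \<in> O(\<lambda>n. 2 powr ((1 - e / 8) * real n))"
    proof -
      have "(\<lambda>n. (1 + K * real n)\<^sup>2) \<in> O(\<lambda>n. 2 powr (d * real n))" if "d > 0" for d
        using that K(1) by real_asymp
      from landau_o.big.mult[OF landau_o.big_refl this, of "e / 8" "\<lambda>n. C * 2 powr ((1 - e / 4) * real n)"]
      have "(\<lambda>n. time_bound C e n (K * real n)) \<in>
          O(\<lambda>n. C * 2 powr ((1 - e / 4) * real n) * 2 powr (e / 8 * real n))"
        using e(1) by (simp add: time_bound_def)
      also have "(\<lambda>n. C * 2 powr ((1 - e / 4) * real n) * 2 powr (e / 8 * real n)) =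
          (\<lambda>n. C * 2 powr ((1 - e / 8) * real n))"
        by (simp add: fun_eq_iff flip: powr_add) (simp add: algebra_simps)
      finally show ?thesis using C by simp
    qed
    finally show "(\<lambda>n. time_bound C e n \<bar>g n\<bar>) \<in> O(\<lambda>n. 2 powr ((1 - e / 8) * real n))" .
  qed
  \<comment> \<open>Here the factor in the number of clauses is an allowed polynomial, so the saving
    \<open>e / 4\<close> remains. It is the same for every \<open>k\<close>, which contradicts
    \<open>SETH\<close>.\<close>
  have "\<exists>P (p :: real poly). solves P (is_kcnf k) enc_cnf (\<lambda>\<phi>. of_bool (satisfiable \<phi>))
      (\<lambda>(n, F). 2 powr ((1 - e / 4) * real n) * poly p (real (length F)))" for k
  proof (intro exI)
    show "solves (via_sat_graph P Equal 2) (is_kcnf k) enc_cnf (\<lambda>\<phi>. of_bool (satisfiable \<phi>))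
        (\<lambda>(n, F). 2 powr ((1 - e / 4) * real n) * poly (smult C ([:1, 1:]\<^sup>2)) (real (length F)))"
      by (rule solves_mono[OF solver[of 2 "\<lambda>m. m + 1" Equal]])
         (auto simp: time_bound_def is_kcnf_def satisfiable_iff_max_sat ac_simps)
  qed
  then have "\<not> SETH"
    unfolding SETH_def using e(1) by (metis divide_pos_pos zero_less_numeral)
  then show ?thesis
    using max_sat e(1) by (intro conjI exI[of _ "e / 8"]) auto
qed

end
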